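(* Let $\alpha,\beta\in\mathbb{C}\setminus\{-1,-2,-3,\ldots\}$ with $\alpha+\beta\notin\{-2,-3,-4,\ldots\}$. Consider the bilinear functional on $\mathbb{C}[x]$ $$\mathcal{B}_{\alpha,\beta}(f,g)=\mathrm{f.p.}\!\int_0^1 x^{\alpha}(1-x)^\beta f(x)g(x)\,dx ,$$ and the Jacobi polynomials on $[0,1]$, $P_n^{(\alpha,\beta)}$ ($n=0,1,2,\ldots$), normalized by $$P_n^{(\alpha,\beta)}(x)=w(x)^{-1}\frac{d^n}{dx^n}\left[(x-x^2)^n w(x)\right],\qquad w(x)=x^\alpha(1-x)^\beta .$$ Then for all integers $n,k\ge0$ $$\mathcal{B}_{\alpha,\beta}\left(P_n^{(\alpha,\beta)},P_k^{(\alpha,\beta)}\right)=0\ \text{ for } k\ne n$$ and $$\mathcal{B}_{\alpha,\beta}\left(P_n^{(\alpha,\beta)},P_n^{(\alpha,\beta)}\right)=(-1)^n\,n!\,C_n\,\frac{\Gamma(\alpha+n+1)\Gamma(\beta+n+1)}{\Gamma(\alpha+\beta+2n+2)}\neq 0,$$ where $C_n=(-1)^n\prod_{k=1}^n(k+n+\alpha+\beta)$.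
   Context: Hadamard finite part on $[0,1]$: let $\alpha,\beta\in\mathbb{C}\setminus\{-1,-2,\ldots\}$ and let $F$ be analytic on $[0,1]$. Write the Taylor expansions at $0$: $(1-t)^\beta F(t)=\sum_{m\ge0}a_m t^m$ and $(1-s)^\alpha F(1-s)=\sum_{m\ge0}b_m s^m$. Then $$\mathrm{f.p.}\!\int_0^1 t^\alpha(1-t)^\beta F(t)\,dt:=\sum_{m\ge0}\frac{a_m}{m+\alpha+1}\,\xi_0^{m+\alpha+1}+\int_{\xi_0}^{\xi_1}t^\alpha(1-t)^\beta F(t)\,dt+\sum_{m\ge0}\frac{b_m}{m+\beta+1}\,(1-\xi_1)^{m+\beta+1},$$ where $0<\xi_0\le\xi_1<1$ are any numbers such that $\xi_0$ and $1-\xi_1$ are smaller than the radii of convergence of the respective series (the value does not depend on them), and for $t\in(0,1)$ the usual branches $t^\alpha=e^{\alpha\ln t}$, $(1-t)^\beta=e^{\beta\ln(1-t)}$ are used. When $\Re\alpha,\Re\beta>-1$ this is the ordinary integral. In $\mathcal{B}_{\alpha,\beta}(f,g)$ one takes $F=fg$. The functions $P_n^{(\alpha,\beta)}$ defined in the claim are polynomials, and the coefficient of $x^n$ in $P_n^{(\alpha,\beta)}$ is $C_n$. *)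

theory Defs
  imports "HOL-Complex_Analysis.Complex_Analysis"
begin

definition hfp_coeffs :: "complex \<Rightarrow> (complex \<Rightarrow> complex) \<Rightarrow> complex fps" where
  "hfp_coeffs b G = fps_expansion (\<lambda>t. (1 - t) powr b * G t) 0"

text \<open>The value obtained from cut points \<open>\<xi>0\<close>, \<open>\<xi>1\<close>. All bases of powers are positive reals on the
  range of integration, where \<open>powr\<close> is the usual branch \<open>t\<^sup>a = exp (a ln t)\<close>.\<close>

definition hfp_split ::
    "complex \<Rightarrow> complex \<Rightarrow> (complex \<Rightarrow> complex) \<Rightarrow> real \<Rightarrow> real \<Rightarrow> complex" where
  "hfp_split \<alpha> \<beta> F \<xi>0 \<xi>1 =
     (\<Sum>m. fps_nth (hfp_coeffs \<beta> F) m / (of_nat m + \<alpha> + 1)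
            * of_real \<xi>0 powr (of_nat m + \<alpha> + 1))
     + integral {\<xi>0..\<xi>1}
         (\<lambda>t. of_real t powr \<alpha> * of_real (1 - t) powr \<beta> * F (of_real t))
     + (\<Sum>m. fps_nth (hfp_coeffs \<alpha> (\<lambda>s. F (1 - s))) m / (of_nat m + \<beta> + 1)
            * of_real (1 - \<xi>1) powr (of_nat m + \<beta> + 1))"

definition hfp_admissible ::
    "complex \<Rightarrow> complex \<Rightarrow> (complex \<Rightarrow> complex) \<Rightarrow> real \<Rightarrow> real \<Rightarrow> bool" where
  "hfp_admissible \<alpha> \<beta> F \<xi>0 \<xi>1 \<longleftrightarrow>
     0 < \<xi>0 \<and> \<xi>0 \<le> \<xi>1 \<and> \<xi>1 < 1
     \<and> ereal \<xi>0 < fps_conv_radius (hfp_coeffs \<beta> F)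
     \<and> ereal (1 - \<xi>1) < fps_conv_radius (hfp_coeffs \<alpha> (\<lambda>s. F (1 - s)))"

text \<open>The Hadamard finite part of the integral of \<open>t\<^sup>\<alpha> (1 - t)\<^sup>\<beta> F t\<close> over \<open>[0,1]\<close>, for \<open>F\<close>
  analytic on \<open>[0,1]\<close> and \<open>\<alpha>, \<beta>\<close> not negative integers: the common value of all admissible
  splittings.\<close>

definition hadamard_fp :: "complex \<Rightarrow> complex \<Rightarrow> (complex \<Rightarrow> complex) \<Rightarrow> complex" where
  "hadamard_fp \<alpha> \<beta> F =
     (THE v. \<forall>\<xi>0 \<xi>1. hfp_admissible \<alpha> \<beta> F \<xi>0 \<xi>1 \<longrightarrow> hfp_split \<alpha> \<beta> F \<xi>0 \<xi>1 = v)"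

definition jacobi_form :: "complex \<Rightarrow> complex \<Rightarrow> complex poly \<Rightarrow> complex poly \<Rightarrow> complex" where
  "jacobi_form \<alpha> \<beta> f g = hadamard_fp \<alpha> \<beta> (\<lambda>x. poly f x * poly g x)"

definition jacobi_weight :: "complex \<Rightarrow> complex \<Rightarrow> complex \<Rightarrow> complex" where
  "jacobi_weight \<alpha> \<beta> x = x powr \<alpha> * (1 - x) powr \<beta>"

text \<open>The Rodrigues formula defines a function on \<open>(0,1)\<close>, which agrees there with exactly one
  polynomial. The weight is holomorphic near \<open>(0,1)\<close>, so the complex derivative at a point of
  \<open>(0,1)\<close> is the derivative along the real line.\<close>

definition jacobi_poly :: "complex \<Rightarrow> complex \<Rightarrow> nat \<Rightarrow> complex poly" where
  "jacobi_poly \<alpha> \<beta> n =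
     (THE p. \<forall>x\<in>{0<..<1::real}. poly p (of_real x) =
        inverse (jacobi_weight \<alpha> \<beta> (of_real x))
        * (deriv ^^ n) (\<lambda>z. (z - z\<^sup>2) ^ n * jacobi_weight \<alpha> \<beta> z) (of_real x))"

definition jacobi_lead :: "complex \<Rightarrow> complex \<Rightarrow> nat \<Rightarrow> complex" where
  "jacobi_lead \<alpha> \<beta> n = (-1) ^ n * (\<Prod>k=1..n. of_nat k + of_nat n + \<alpha> + \<beta>)"

end

theory Submission
  imports Defs
begin

text \<open>The two series in the finite part are formal antiderivatives: if \<open>t\<^sup>a f t\<close> is the derivative of
  \<open>t\<^bsup>a+1\<^esup> g t\<close> with \<open>f\<close>, \<open>g\<close> power series, then the series for \<open>f\<close> is \<open>\<xi>\<^bsup>a+1\<^esup> g \<xi>\<close>. Hence the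
  finite part of the derivative of \<open>t\<^bsup>\<alpha>+1\<^esup> (1 - t)\<^bsup>\<beta>+1\<^esup> p t\<close> vanishes, for all admissible exponents and without any
  analytic continuation. Taking \<open>p = 1\<close> gives the recurrence of the Beta function, so the finite
  part of the weight equals Beta once this is known for large real parts, where it is the ordinary
  integral. For general \<open>p\<close> it is integration by parts: \<open>n\<close>-fold application to the Rodrigues
  formula moves all derivatives to the second factor, which gives orthogonality and the norm.\<close>

subsection \<open>The series at the endpoints\<close>

text \<open>This is the series g for which t^(a+1) g(t) is the formal antiderivative of t^a A(t),
  with no constant of integration.\<close>

definition fps_integ :: "complex \<Rightarrow> complex fps \<Rightarrow> complex fps" where
  "fps_integ a A = Abs_fps (\<lambda>m. fps_nth A m / (of_nat m + a + 1))"

definition edge_sum :: "complex \<Rightarrow> complex fps \<Rightarrow> real \<Rightarrow> complex" where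
  "edge_sum a A \<xi> =
     (\<Sum>m. fps_nth A m / (of_nat m + a + 1) * of_real \<xi> powr (of_nat m + a + 1))"

definition one_minus_powr_fps :: "complex \<Rightarrow> complex fps" where
  "one_minus_powr_fps b = fps_expansion (\<lambda>t. (1 - t) powr b) 0"

lemma hfp_split_edge_sum:
  "hfp_split \<alpha> \<beta> F \<xi>0 \<xi>1 = edge_sum \<alpha> (hfp_coeffs \<beta> F) \<xi>0
     + integral {\<xi>0..\<xi>1} (\<lambda>t. of_real t powr \<alpha> * of_real (1 - t) powr \<beta> * F (of_real t))
     + edge_sum \<beta> (hfp_coeffs \<alpha> (\<lambda>s. F (1 - s))) (1 - \<xi>1)"
  by (simp add: hfp_split_def edge_sum_def)

lemma of_nat_plus_neq_0:
  fixes a :: complex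
  assumes "a \<notin> \<int>\<^sub>\<le>\<^sub>0"
  shows "of_nat m + a \<noteq> 0"
proof
  assume "of_nat m + a = 0"
  then have "a = - of_nat m" by (simp add: eq_neg_iff_add_eq_0 add.commute)
  then show False using assms by simp
qed

lemma fps_integ_conv_radius: "fps_conv_radius (fps_integ a A) \<ge> fps_conv_radius A"
  unfolding fps_conv_radius_def
proof (rule conv_radius_geI_ex)
  fix r :: real assume r: "0 < r" "ereal r < conv_radius (fps_nth A)"
  have s: "summable (\<lambda>n. norm (fps_nth A n * of_real r ^ n))"
    by (rule abs_summable_in_conv_radius) (use r in auto)
  \<comment> \<open>From this index on the divisor n + a + 1 has norm at least 1, so dividing by it
    only shrinks the coefficient.\<close>
  have "eventually (\<lambda>n. n \<ge> nat \<lceil>norm (a + 1) + 1\<rceil>) sequentially"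
    by (rule eventually_ge_at_top)
  then have ev: "eventually (\<lambda>n. norm (fps_nth (fps_integ a A) n * of_real r ^ n)
      \<le> norm (fps_nth A n * of_real r ^ n)) sequentially"
  proof eventually_elim
    case (elim n)
    have "norm (a + 1) + 1 \<le> real n" using elim by linarith
    moreover have "norm (of_nat n + (a + 1)) \<ge> norm (of_nat n :: complex) - norm (a + 1)"
      by (rule norm_diff_ineq)
    ultimately have g: "norm (of_nat n + a + 1) \<ge> 1" by (simp add: add.assoc)
    have "norm (fps_nth A n) / norm (of_nat n + a + 1) \<le> norm (fps_nth A n) / 1"
      by (intro divide_left_mono) (use g in auto)
    then have "norm (fps_nth A n) / norm (of_nat n + a + 1) * r ^ n \<le> norm (fps_nth A n) * r ^ n"
      by (intro mult_right_mono) (use r in auto)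
    then show ?case using r by (simp add: fps_integ_def norm_mult norm_divide norm_power)
  qed
  have "summable (\<lambda>n. fps_nth (fps_integ a A) n * of_real r ^ n)"
    by (rule summable_comparison_test_ev[OF ev s])
  then show "\<exists>z::complex. norm z = r \<and> summable (\<lambda>n. fps_nth (fps_integ a A) n * z ^ n)"
    using r by (intro exI[of _ "of_real r"]) auto
qed

text \<open>The operator t^(-a) (d/dt) t^(a+1) multiplies the n-th coefficient by n + a + 1, which
  never vanishes here. An antiderivative known in closed form is thus recognised by differentiating
  it.\<close>

lemma fps_integ_unique:
  assumes "a + 1 \<notin> \<int>\<^sub>\<le>\<^sub>0" and "A = fps_const (a + 1) * G + fps_X * fps_deriv G"
  shows "fps_integ a A = G"
proof (rule fps_ext)
  fix n
  have nz: "of_nat n + a + 1 \<noteq> 0"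
    using of_nat_plus_neq_0[OF assms(1), of n] by (simp add: add.assoc)
  have "fps_nth A n = (of_nat n + a + 1) * fps_nth G n"
    unfolding assms(2) by (cases n) (auto simp: algebra_simps)
  then show "fps_nth (fps_integ a A) n = fps_nth G n"
    using nz by (simp add: fps_integ_def)
qed

text \<open>The converse direction; it supplies the derivative for the fundamental theorem of
  calculus when the integral converges at the endpoint.\<close>

lemma fps_integ_ODE:
  assumes "a + 1 \<notin> \<int>\<^sub>\<le>\<^sub>0"
  shows "fps_const (a + 1) * fps_integ a A + fps_X * fps_deriv (fps_integ a A) = A"
proof (rule fps_ext)
  fix n
  have nz: "of_nat n + a + 1 \<noteq> 0"
    using of_nat_plus_neq_0[OF assms(1), of n] by (simp add: add.assoc)
  have "fps_nth (fps_const (a + 1) * fps_integ a A + fps_X * fps_deriv (fps_integ a A)) n =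
     (of_nat n + a + 1) * fps_nth (fps_integ a A) n"
    by (cases n) (auto simp: algebra_simps)
  then show "fps_nth (fps_const (a + 1) * fps_integ a A + fps_X * fps_deriv (fps_integ a A)) n = fps_nth A n"
    using nz by (simp add: fps_integ_def)
qed

lemma fps_integ_add: "fps_integ a (A + B) = fps_integ a A + fps_integ a B"
  by (rule fps_ext) (simp add: fps_integ_def add_divide_distrib)

lemma fps_integ_cmult: "fps_integ a (fps_const c * A) = fps_const c * fps_integ a A"
  by (rule fps_ext) (simp add: fps_integ_def)

lemma fps_integ_shift: "fps_integ a (fps_X * A) = fps_X * fps_integ (a + 1) A"
proof (rule fps_ext)
  fix n show "fps_nth (fps_integ a (fps_X * A)) n = fps_nth (fps_X * fps_integ (a + 1) A) n"
    by (cases n) (auto simp: fps_integ_def algebra_simps)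
qed

lemma edge_sum_eval:
  assumes "0 < \<xi>" "ereal \<xi> < fps_conv_radius A"
  shows "edge_sum a A \<xi> = of_real \<xi> powr (a + 1) * eval_fps (fps_integ a A) (of_real \<xi>)"
proof -
  have "summable (\<lambda>m. fps_nth (fps_integ a A) m * of_real \<xi> ^ m)"
    by (rule summable_fps) (use assms fps_integ_conv_radius[of A a] in auto)
  then have "of_real \<xi> powr (a + 1) * eval_fps (fps_integ a A) (of_real \<xi>) =
      (\<Sum>m. of_real \<xi> powr (a + 1) * (fps_nth (fps_integ a A) m * of_real \<xi> ^ m))"
    unfolding eval_fps_def by (rule suminf_mult[symmetric])
  also have "\<dots> = edge_sum a A \<xi>"
    unfolding edge_sum_def
    by (intro suminf_cong)
       (use assms in \<open>simp add: fps_integ_def powr_add powr_nat' add.assoc\<close>)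
  finally show ?thesis ..
qed

section \<open>The binomial series of (1 - t)^b\<close>

lemma one_minus_powr_holomorphic:
  "(\<lambda>t. (1 - t) powr b) holomorphic_on ball 0 1"
proof (intro holomorphic_intros)
  fix t :: complex assume "t \<in> ball 0 1"
  then have "Re t < 1" using complex_Re_le_cmod[of t] by simp
  then show "1 - t \<notin> \<real>\<^sub>\<le>\<^sub>0" by (auto simp: complex_nonpos_Reals_iff)
qed

lemma one_minus_powr_expansion:
  "(\<lambda>t. (1 - t) powr b) has_fps_expansion one_minus_powr_fps b"
  unfolding one_minus_powr_fps_def
  by (rule has_fps_expansion_fps_expansion[OF _ _ one_minus_powr_holomorphic]) auto

lemma one_minus_powr_conv_radius: "fps_conv_radius (one_minus_powr_fps b) \<ge> 1"
  using holomorphic_on_imp_fps_conv_radius_ge[OF one_minus_powr_expansion[of b], of 1]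
    one_minus_powr_holomorphic by (simp add: one_ereal_def)

lemma one_minus_powr_eval:
  "norm t < 1 \<Longrightarrow> eval_fps (one_minus_powr_fps b) t = (1 - t) powr b"
  by (rule has_fps_expansion_imp_eval_fps_eq[OF one_minus_powr_expansion _ one_minus_powr_holomorphic])

lemma has_fps_expansion_poly: "poly p has_fps_expansion fps_of_poly p"
  by (simp add: has_fps_expansion_def)

lemma one_minus_powr_fps_plus1:
  "one_minus_powr_fps (b + 1) = (1 - fps_X) * one_minus_powr_fps b"
proof (rule fps_expansion_unique_complex[OF one_minus_powr_expansion])
  have "(\<lambda>t. (1 - t) * (1 - t) powr b) has_fps_expansion (1 - fps_X) * one_minus_powr_fps b"
    by (intro fps_expansion_intros one_minus_powr_expansion)
  moreover have "eventually (\<lambda>t::complex. t \<in> ball 0 1) (nhds 0)"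
    by (intro eventually_nhds_in_open) auto
  then have "eventually (\<lambda>t::complex. (1 - t) * (1 - t) powr b = (1 - t) powr (b + 1)) (nhds 0)"
    by eventually_elim (auto simp: powr_add)
  ultimately show "(\<lambda>t. (1 - t) powr (b + 1)) has_fps_expansion (1 - fps_X) * one_minus_powr_fps b"
    by (subst (asm) has_fps_expansion_cong[OF _ refl]) auto
qed

lemma one_minus_powr_fps_deriv:
  "fps_deriv (one_minus_powr_fps (b + 1)) = - fps_const (b + 1) * one_minus_powr_fps b"
proof (rule fps_expansion_unique_complex)
  show "deriv (\<lambda>t. (1 - t) powr (b + 1)) has_fps_expansion fps_deriv (one_minus_powr_fps (b + 1))"
    by (intro fps_expansion_intros one_minus_powr_expansion)
  have "(\<lambda>t. - (b + 1) * (1 - t) powr b) has_fps_expansion - fps_const (b + 1) * one_minus_powr_fps b"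
    by (subst fps_const_neg) (intro fps_expansion_intros one_minus_powr_expansion)
  moreover have "eventually (\<lambda>t::complex. t \<in> ball 0 1) (nhds 0)"
    by (intro eventually_nhds_in_open) auto
  then have "eventually (\<lambda>t::complex. - (b + 1) * (1 - t) powr b = deriv (\<lambda>t. (1 - t) powr (b + 1)) t) (nhds 0)"
  proof eventually_elim
    case (elim t)
    have "Re t < 1" using elim complex_Re_le_cmod[of t] by simp
    then have "1 - t \<notin> \<real>\<^sub>\<le>\<^sub>0" by (auto simp: complex_nonpos_Reals_iff)
    then have "((\<lambda>t. (1 - t) powr (b + 1)) has_field_derivative - (b + 1) * (1 - t) powr b) (at t)"
      by (auto intro!: derivative_eq_intros simp: algebra_simps)
    then show ?case by (rule DERIV_imp_deriv[symmetric])
  qed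
  ultimately show "deriv (\<lambda>t. (1 - t) powr (b + 1)) has_fps_expansion - fps_const (b + 1) * one_minus_powr_fps b"
    by (subst (asm) has_fps_expansion_cong[OF _ refl]) auto
qed

lemma hfp_coeffs_poly:
  "hfp_coeffs b (poly p) = one_minus_powr_fps b * fps_of_poly p"
  unfolding hfp_coeffs_def
  by (intro fps_expansion_eqI has_fps_expansion_mult one_minus_powr_expansion has_fps_expansion_poly)

lemma hfp_coeffs_poly_conv_radius: "fps_conv_radius (hfp_coeffs b (poly p)) \<ge> 1"
  unfolding hfp_coeffs_poly
  by (rule order.trans[OF _ fps_conv_radius_mult]) (simp add: one_minus_powr_conv_radius)

lemma hfp_coeffs_poly_eval:
  "norm t < 1 \<Longrightarrow> eval_fps (hfp_coeffs b (poly p)) t = (1 - t) powr b * poly p t"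
  unfolding hfp_coeffs_poly
  by (subst eval_fps_mult)
     (auto simp: one_minus_powr_eval intro: less_le_trans[OF _ one_minus_powr_conv_radius])

lemma edge_sum_poly:
  assumes "0 < \<xi>" "\<xi> < 1"
  shows "edge_sum a (hfp_coeffs b (poly p)) \<xi> =
    of_real \<xi> powr (a + 1) * eval_fps (fps_integ a (hfp_coeffs b (poly p))) (of_real \<xi>)"
  by (rule edge_sum_eval)
     (use assms in \<open>auto intro: less_le_trans[OF _ hfp_coeffs_poly_conv_radius]\<close>)

subsection \<open>Finite parts of polynomials\<close>

lemma has_integral_one_minus:
  fixes f :: "real \<Rightarrow> complex"
  assumes "(f has_integral I) {a..b}"
  shows "((\<lambda>t. f (1 - t)) has_integral I) {1 - b..1 - a}"
proof (cases "a \<le> b")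
  case True
  then have "(\<lambda>x. 1 - x) ` {a..b} = {1 - b..1 - a}"
    using image_affinity_atLeastAtMost[of "-1" 1 a b] by (simp add: add.commute)
  then show ?thesis
    using has_integral_affinity[of f I a b "-1" 1] assms by (simp add: add.commute)
qed (use assms in auto)

text \<open>Under t = 1 - s the two endpoint series change places by definition, so only the middle
  integral needs a substitution. Facts about the right endpoint and about \<beta> are later drawn
  from those about the left endpoint and \<alpha>.\<close>

lemma hfp_split_reflect:
  assumes int: "(\<lambda>t. of_real t powr \<alpha> * of_real (1 - t) powr \<beta> * F (of_real t)) integrable_on {\<xi>0..\<xi>1}"
  shows "hfp_split \<alpha> \<beta> F \<xi>0 \<xi>1 = hfp_split \<beta> \<alpha> (\<lambda>s. F (1 - s)) (1 - \<xi>1) (1 - \<xi>0)"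
proof -
  have "integral {1 - \<xi>1..1 - \<xi>0} (\<lambda>t. of_real t powr \<beta> * of_real (1 - t) powr \<alpha> * F (1 - of_real t)) =
     integral {\<xi>0..\<xi>1} (\<lambda>t. of_real t powr \<alpha> * of_real (1 - t) powr \<beta> * F (of_real t))"
    using has_integral_one_minus[OF integrable_integral[OF int]]
    by (intro integral_unique) (simp add: mult.commute mult.left_commute)
  then show ?thesis
    by (simp add: hfp_split_edge_sum add_ac)
qed

lemma jacobi_integrand_continuous:
  fixes \<alpha> \<beta> :: complex
  assumes "0 < \<xi>0" "\<xi>1 < 1"
  shows "continuous_on {\<xi>0..\<xi>1}
    (\<lambda>t. of_real t powr \<alpha> * of_real (1 - t) powr \<beta> * poly p (of_real t))"
  by (intro continuous_intros)
     (use assms in \<open>auto simp: complex_nonpos_Reals_iff simp flip: of_real_diff\<close>)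

lemma jacobi_integrand_integrable:
  fixes \<alpha> \<beta> :: complex
  assumes "0 < \<xi>0" "\<xi>1 < 1"
  shows "(\<lambda>t. of_real t powr \<alpha> * of_real (1 - t) powr \<beta> * poly p (of_real t)) integrable_on {\<xi>0..\<xi>1}"
  using jacobi_integrand_continuous[OF assms] by (rule integrable_continuous_real)

text \<open>Substitution of 1 - x, not the coefficient reversal \<open>reflect_poly\<close>. It
  keeps the function at the right endpoint a polynomial, so that the same lemmas serve both
  ends.\<close>

abbreviation reflect_poly01 :: "complex poly \<Rightarrow> complex poly" where
  "reflect_poly01 p \<equiv> pcompose p [:1, -1:]"

lemma poly_reflect01: "(\<lambda>s. poly p (1 - s)) = poly (reflect_poly01 p)"
  by (auto simp: poly_pcompose)

lemma hfp_split_poly_reflect: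
  assumes "0 < \<xi>0" "\<xi>1 < 1"
  shows "hfp_split \<alpha> \<beta> (poly p) \<xi>0 \<xi>1 =
    hfp_split \<beta> \<alpha> (poly (reflect_poly01 p)) (1 - \<xi>1) (1 - \<xi>0)"
  using hfp_split_reflect[OF jacobi_integrand_integrable[OF assms]] by (simp add: poly_reflect01)

section \<open>Linearity, and absorption of the factors x and 1 - x into the exponents\<close>

lemma edge_sum_poly_add:
  assumes "0 < \<xi>" "\<xi> < 1"
  shows "edge_sum a (hfp_coeffs b (poly (p + q))) \<xi> =
    edge_sum a (hfp_coeffs b (poly p)) \<xi> + edge_sum a (hfp_coeffs b (poly q)) \<xi>"
proof -
  have r: "ereal (norm (of_real \<xi> :: complex)) < fps_conv_radius (fps_integ a (hfp_coeffs b (poly p)))" for p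
    using assms
    by (intro less_le_trans[OF _ fps_integ_conv_radius] less_le_trans[OF _ hfp_coeffs_poly_conv_radius]) auto
  have "hfp_coeffs b (poly (p + q)) = hfp_coeffs b (poly p) + hfp_coeffs b (poly q)"
    by (simp add: hfp_coeffs_poly fps_of_poly_add distrib_left)
  then show ?thesis
    using r unfolding edge_sum_poly[OF assms] by (simp add: fps_integ_add eval_fps_add distrib_left)
qed

lemma edge_sum_poly_smult:
  assumes "0 < \<xi>" "\<xi> < 1"
  shows "edge_sum a (hfp_coeffs b (poly (smult c p))) \<xi> = c * edge_sum a (hfp_coeffs b (poly p)) \<xi>"
proof -
  have r: "ereal (norm (of_real \<xi> :: complex)) < fps_conv_radius (fps_integ a (hfp_coeffs b (poly p)))"
    using assms
    by (intro less_le_trans[OF _ fps_integ_conv_radius] less_le_trans[OF _ hfp_coeffs_poly_conv_radius]) auto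
  have "hfp_coeffs b (poly (smult c p)) = fps_const c * hfp_coeffs b (poly p)"
    by (simp add: hfp_coeffs_poly fps_of_poly_smult mult.left_commute)
  then show ?thesis
    using r unfolding edge_sum_poly[OF assms] by (simp add: fps_integ_cmult eval_fps_mult)
qed

lemma edge_sum_poly_shift:
  assumes "0 < \<xi>" "\<xi> < 1"
  shows "edge_sum a (hfp_coeffs b (poly (pCons 0 p))) \<xi> = edge_sum (a + 1) (hfp_coeffs b (poly p)) \<xi>"
proof -
  have r: "ereal (norm (of_real \<xi> :: complex)) < fps_conv_radius (fps_integ (a+1) (hfp_coeffs b (poly p)))"
    using assms
    by (intro less_le_trans[OF _ fps_integ_conv_radius] less_le_trans[OF _ hfp_coeffs_poly_conv_radius]) auto
  have "hfp_coeffs b (poly (pCons 0 p)) = fps_X * hfp_coeffs b (poly p)"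
    by (simp add: hfp_coeffs_poly fps_of_poly_pCons mult_ac)
  then show ?thesis
    using r assms(1) unfolding edge_sum_poly[OF assms]
    by (simp add: fps_integ_shift eval_fps_mult powr_add power2_eq_square)
qed

lemma hfp_split_poly_add:
  assumes "0 < \<xi>0" "\<xi>0 \<le> \<xi>1" "\<xi>1 < 1"
  shows "hfp_split \<alpha> \<beta> (poly (p + q)) \<xi>0 \<xi>1 =
    hfp_split \<alpha> \<beta> (poly p) \<xi>0 \<xi>1 + hfp_split \<alpha> \<beta> (poly q) \<xi>0 \<xi>1"
proof -
  have b: "0 < \<xi>0" "\<xi>0 < 1" "0 < 1 - \<xi>1" "1 - \<xi>1 < 1" using assms by auto
  have "integral {\<xi>0..\<xi>1} (\<lambda>t. of_real t powr \<alpha> * of_real (1 - t) powr \<beta> * poly (p + q) (of_real t)) =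
    integral {\<xi>0..\<xi>1} (\<lambda>t. of_real t powr \<alpha> * of_real (1 - t) powr \<beta> * poly p (of_real t)) +
    integral {\<xi>0..\<xi>1} (\<lambda>t. of_real t powr \<alpha> * of_real (1 - t) powr \<beta> * poly q (of_real t))"
    using integral_add[OF jacobi_integrand_integrable[OF assms(1,3), of \<alpha> \<beta> p] jacobi_integrand_integrable[OF assms(1,3), of \<alpha> \<beta> q]]
    by (simp only: poly_add distrib_left)
  then show ?thesis
    by (simp only: hfp_split_edge_sum poly_reflect01 pcompose_add edge_sum_poly_add[OF b(1,2)]
        edge_sum_poly_add[OF b(3,4)] add_ac)
qed

lemma hfp_split_poly_smult:
  assumes "0 < \<xi>0" "\<xi>0 \<le> \<xi>1" "\<xi>1 < 1"
  shows "hfp_split \<alpha> \<beta> (poly (smult c p)) \<xi>0 \<xi>1 = c * hfp_split \<alpha> \<beta> (poly p) \<xi>0 \<xi>1"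
proof -
  have b: "0 < \<xi>0" "\<xi>0 < 1" "0 < 1 - \<xi>1" "1 - \<xi>1 < 1" using assms by auto
  have "integral {\<xi>0..\<xi>1} (\<lambda>t. of_real t powr \<alpha> * of_real (1 - t) powr \<beta> * poly (smult c p) (of_real t)) =
    c * integral {\<xi>0..\<xi>1} (\<lambda>t. of_real t powr \<alpha> * of_real (1 - t) powr \<beta> * poly p (of_real t))"
    by (subst integral_mult_right[symmetric]) (simp add: mult_ac)
  then show ?thesis
    by (simp only: hfp_split_edge_sum poly_reflect01 pcompose_smult edge_sum_poly_smult[OF b(1,2)]
        edge_sum_poly_smult[OF b(3,4)] distrib_left)
qed

lemma hfp_split_poly_shift:
  assumes "0 < \<xi>0" "\<xi>0 \<le> \<xi>1" "\<xi>1 < 1"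
  shows "hfp_split \<alpha> \<beta> (poly (pCons 0 p)) \<xi>0 \<xi>1 = hfp_split (\<alpha> + 1) \<beta> (poly p) \<xi>0 \<xi>1"
proof -
  have b: "0 < \<xi>0" "\<xi>0 < 1" using assms by auto
  have 1: "integral {\<xi>0..\<xi>1} (\<lambda>t. of_real t powr \<alpha> * of_real (1 - t) powr \<beta> * poly (pCons 0 p) (of_real t)) =
    integral {\<xi>0..\<xi>1} (\<lambda>t. of_real t powr (\<alpha> + 1) * of_real (1 - t) powr \<beta> * poly p (of_real t))"
    using b by (intro integral_cong) (auto simp: powr_add)
  \<comment> \<open>Seen from the right endpoint the factor x is 1 - s, which raises the exponent of
    the binomial series instead of shifting the coefficients.\<close>
  have 2: "hfp_coeffs \<alpha> (poly (reflect_poly01 (pCons 0 p))) =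
      hfp_coeffs (\<alpha> + 1) (poly (reflect_poly01 p))"
  proof -
    have "fps_of_poly [:1, -1:] = (1 - fps_X :: complex fps)"
      by (simp add: fps_of_poly_pCons flip: fps_const_neg)
    then have "fps_of_poly (reflect_poly01 (pCons 0 p)) = (1 - fps_X) * fps_of_poly (reflect_poly01 p)"
      by (simp only: pcompose_pCons pCons_0_0 add_0_left fps_of_poly_mult)
    then show ?thesis
      by (simp only: hfp_coeffs_poly one_minus_powr_fps_plus1 mult_ac)
  qed
  show ?thesis
    by (simp only: hfp_split_edge_sum poly_reflect01 1 2 edge_sum_poly_shift[OF b])
qed

lemma hfp_split_poly_shift_one_minus:
  assumes "0 < \<xi>0" "\<xi>0 \<le> \<xi>1" "\<xi>1 < 1"
  shows "hfp_split \<alpha> \<beta> (poly ([:1, -1:] * p)) \<xi>0 \<xi>1 = hfp_split \<alpha> (\<beta> + 1) (poly p) \<xi>0 \<xi>1"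
proof -
  have b: "0 < 1 - \<xi>1" "1 - \<xi>1 \<le> 1 - \<xi>0" "1 - \<xi>0 < 1" using assms by auto
  have "reflect_poly01 ([:1, -1:] * p) = pCons 0 (reflect_poly01 p)"
    by (simp only: pcompose_mult) (simp add: pcompose_pCons)
  then show ?thesis
    by (simp only: hfp_split_poly_reflect[OF assms(1,3)] hfp_split_poly_shift[OF b])
qed

text \<open>\<open>t\<^sup>\<alpha> (1 - t)\<^sup>\<beta>\<close> times this polynomial is the derivative of
  \<open>t\<^bsup>\<alpha>+1\<^esup> (1 - t)\<^bsup>\<beta>+1\<^esup> p t\<close>.\<close>

definition rodrigues_op :: "complex \<Rightarrow> complex \<Rightarrow> complex poly \<Rightarrow> complex poly" where
  "rodrigues_op \<alpha> \<beta> p = [:\<alpha> + 1, - (\<alpha> + \<beta> + 2):] * p + [:0, 1, -1:] * pderiv p"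

lemma poly_rodrigues_op:
  "poly (rodrigues_op \<alpha> \<beta> p) x =
     ((\<alpha> + 1) * (1 - x) - (\<beta> + 1) * x) * poly p x + x * (1 - x) * poly (pderiv p) x"
  by (simp add: rodrigues_op_def algebra_simps)

text \<open>The sign is that of d/dx = - d/ds for s = 1 - x.\<close>

lemma rodrigues_op_reflect:
  "reflect_poly01 (rodrigues_op \<alpha> \<beta> p) = smult (-1) (rodrigues_op \<beta> \<alpha> (reflect_poly01 p))"
  by (rule poly_eq_poly_eq_iff[THEN iffD1])
     (simp add: fun_eq_iff poly_pcompose poly_rodrigues_op pderiv_pcompose pderiv_pCons algebra_simps)

text \<open>The formal antiderivative is t^(\<alpha>+1) times the series of (1 - t)^(\<beta>+1)
  p(t), by \<open>fps_integ_unique\<close>. This is an identity of power series, so Re \<alpha> is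
  unrestricted.\<close>

lemma edge_sum_rodrigues_op:
  assumes "0 < \<xi>" "\<xi> < 1" "\<alpha> + 1 \<notin> \<int>\<^sub>\<le>\<^sub>0"
  shows "edge_sum \<alpha> (hfp_coeffs \<beta> (poly (rodrigues_op \<alpha> \<beta> p))) \<xi> =
     of_real \<xi> powr (\<alpha> + 1) * of_real (1 - \<xi>) powr (\<beta> + 1) * poly p (of_real \<xi>)"
proof -
  define E where "E = one_minus_powr_fps \<beta>"
  define P where "P = fps_of_poly p"
  \<comment> \<open>Names for the constant series, so that the final ring identity treats them as
    atoms.\<close>
  define ca cb where "ca = fps_const (\<alpha> + 1)" and "cb = fps_const (\<beta> + 1)"
  have P': "fps_of_poly (pderiv p) = fps_deriv P"
    by (simp add: P_def fps_of_poly_pderiv)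
  have c: "fps_const (- (\<alpha> + \<beta> + 2)) = - fps_const (\<alpha> + 1) - fps_const (\<beta> + 1)"
    by (rule fps_ext) simp
  have T: "fps_of_poly (rodrigues_op \<alpha> \<beta> p) =
      (fps_const (\<alpha> + 1) + fps_const (- (\<alpha> + \<beta> + 2)) * fps_X) * P + fps_X * (1 - fps_X) * fps_deriv P"
    unfolding rodrigues_op_def
    unfolding fps_of_poly_add fps_of_poly_mult P' P_def[symmetric]
    by (simp add: fps_of_poly_pCons algebra_simps flip: fps_const_neg)
  have E1: "one_minus_powr_fps (\<beta> + 1) = (1 - fps_X) * E"
    by (simp add: E_def one_minus_powr_fps_plus1)
  have D: "fps_deriv (one_minus_powr_fps (\<beta> + 1) * P) =
      - fps_const (\<beta> + 1) * E * P + (1 - fps_X) * E * fps_deriv P"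
    unfolding fps_deriv_mult one_minus_powr_fps_deriv E_def[symmetric] unfolding E1
    by (simp only: add.commute mult_ac)
  have "fps_integ \<alpha> (hfp_coeffs \<beta> (poly (rodrigues_op \<alpha> \<beta> p))) = hfp_coeffs (\<beta> + 1) (poly p)"
  proof (rule fps_integ_unique[OF assms(3)])
    show "hfp_coeffs \<beta> (poly (rodrigues_op \<alpha> \<beta> p)) =
      fps_const (\<alpha> + 1) * hfp_coeffs (\<beta> + 1) (poly p) + fps_X * fps_deriv (hfp_coeffs (\<beta> + 1) (poly p))"
      unfolding hfp_coeffs_poly T P_def[symmetric] D unfolding E1 E_def[symmetric] c
        ca_def[symmetric] cb_def[symmetric]
      by (simp add: algebra_simps)
  qed
  then show ?thesis
    using assms(1,2) by (simp add: edge_sum_poly hfp_coeffs_poly_eval mult.assoc)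
qed

lemma powr_plus1_has_field_derivative:
  fixes z a :: complex
  assumes "z \<notin> \<real>\<^sub>\<le>\<^sub>0"
  shows "((\<lambda>z. z powr (a + 1)) has_field_derivative (a + 1) * z powr a) (at z)"
  using has_field_derivative_powr[OF assms, of "a + 1"] by simp

lemma jacobi_weight_has_field_derivative:
  assumes z: "z \<notin> \<real>\<^sub>\<le>\<^sub>0" "1 - z \<notin> \<real>\<^sub>\<le>\<^sub>0"
  shows "((\<lambda>z. z powr (\<alpha> + 1) * (1 - z) powr (\<beta> + 1) * poly p z) has_field_derivative
      z powr \<alpha> * (1 - z) powr \<beta> * poly (rodrigues_op \<alpha> \<beta> p) z) (at z)"
proof -
  have nz: "z \<noteq> 0" "1 - z \<noteq> 0" using z by auto
  have "((\<lambda>z. (1 - z) powr (\<beta> + 1)) has_field_derivative (\<beta> + 1) * (1 - z) powr \<beta> * (0 - 1)) (at z)"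
    by (rule DERIV_chain2[where g = "\<lambda>z. 1 - z", OF powr_plus1_has_field_derivative[OF z(2)]]) (intro derivative_intros)
  from DERIV_mult[OF DERIV_mult[OF powr_plus1_has_field_derivative[OF z(1), of \<alpha>] this] poly_DERIV[of p z]]
  show ?thesis
    by (rule DERIV_cong) (use nz in \<open>simp add: poly_rodrigues_op powr_add algebra_simps\<close>)
qed

lemma integral_rodrigues_op:
  fixes \<alpha> \<beta> :: complex and p :: "complex poly"
  assumes "0 < \<xi>0" "\<xi>0 \<le> \<xi>1" "\<xi>1 < 1"
  defines "G \<equiv> \<lambda>\<xi>::real. of_real \<xi> powr (\<alpha> + 1) * of_real (1 - \<xi>) powr (\<beta> + 1) * poly p (of_real \<xi>)"
  shows "integral {\<xi>0..\<xi>1} (\<lambda>t. of_real t powr \<alpha> * of_real (1 - t) powr \<beta>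
           * poly (rodrigues_op \<alpha> \<beta> p) (of_real t)) = G \<xi>1 - G \<xi>0"
proof (rule integral_unique, rule fundamental_theorem_of_calculus[OF assms(2)])
  fix t assume t: "t \<in> {\<xi>0..\<xi>1}"
  then have t: "0 < t" "t < 1" using assms by auto
  then have n: "of_real t \<notin> \<real>\<^sub>\<le>\<^sub>0" "1 - of_real t \<notin> (\<real>\<^sub>\<le>\<^sub>0 :: complex set)"
    by (auto simp: complex_nonpos_Reals_iff)
  have "((\<lambda>z. z powr (\<alpha> + 1) * (1 - z) powr (\<beta> + 1) * poly p z) has_field_derivative
      of_real t powr \<alpha> * (1 - of_real t) powr \<beta> * poly (rodrigues_op \<alpha> \<beta> p) (of_real t)) (at (of_real t))"
    using n by (rule jacobi_weight_has_field_derivative)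
  then have "((\<lambda>z. z powr (\<alpha> + 1) * (1 - z) powr (\<beta> + 1) * poly p z) \<circ> of_real has_vector_derivative
      of_real t powr \<alpha> * (1 - of_real t) powr \<beta> * poly (rodrigues_op \<alpha> \<beta> p) (of_real t)) (at t within {\<xi>0..\<xi>1})"
    by (rule has_vector_derivative_real_field[unfolded o_def, folded o_def])
  then show "(G has_vector_derivative of_real t powr \<alpha> * of_real (1 - t) powr \<beta>
           * poly (rodrigues_op \<alpha> \<beta> p) (of_real t)) (at t within {\<xi>0..\<xi>1})"
    by (simp add: G_def o_def)
qed

text \<open>With G(t) = t^(\<alpha>+1) (1 - t)^(\<beta>+1) p(t), the three terms are G(\<xi>0),
  G(\<xi>1) - G(\<xi>0) and - G(\<xi>1), the last sign coming from the reflection. The endpoints 0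
  and 1 contribute no boundary terms.\<close>

lemma hfp_split_rodrigues_op:
  assumes "0 < \<xi>0" "\<xi>0 \<le> \<xi>1" "\<xi>1 < 1" "\<alpha> + 1 \<notin> \<int>\<^sub>\<le>\<^sub>0" "\<beta> + 1 \<notin> \<int>\<^sub>\<le>\<^sub>0"
  shows "hfp_split \<alpha> \<beta> (poly (rodrigues_op \<alpha> \<beta> p)) \<xi>0 \<xi>1 = 0"
proof -
  have b: "0 < \<xi>0" "\<xi>0 < 1" "0 < 1 - \<xi>1" "1 - \<xi>1 < 1" using assms by auto
  show ?thesis
    unfolding hfp_split_edge_sum poly_reflect01 rodrigues_op_reflect edge_sum_poly_smult[OF b(3,4)]
      edge_sum_rodrigues_op[OF b(1,2) assms(4)] edge_sum_rodrigues_op[OF b(3,4) assms(5)]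
      integral_rodrigues_op[OF assms(1-3)]
    by (simp add: poly_pcompose)
qed

text \<open>For Re a > -1 the antiderivative t^(a+1) g(t) is continuous at 0 with value 0, so the
  formal series is an honest integral.\<close>

lemma edge_sum_has_integral:
  assumes "0 < \<xi>" "\<xi> < 1" "Re a > -1"
  shows "((\<lambda>t. of_real t powr a * of_real (1 - t) powr b * poly p (of_real t)) has_integral
      edge_sum a (hfp_coeffs b (poly p)) \<xi>) {0..\<xi>}"
proof -
  have a: "a + 1 \<notin> \<int>\<^sub>\<le>\<^sub>0" using assms(3) by (auto elim!: nonpos_Ints_cases simp: complex_eq_iff)
  define A where "A = hfp_coeffs b (poly p)"
  define g where "g = fps_integ a A"
  define G where "G = (\<lambda>t::real. of_real t powr (a + 1) * eval_fps g (of_real t))"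
  have r: "1 \<le> fps_conv_radius g"
    unfolding g_def A_def
    by (rule order.trans[OF hfp_coeffs_poly_conv_radius fps_integ_conv_radius])
  have r': "ereal (norm (of_real t :: complex)) < fps_conv_radius g" if "t \<in> {0..\<xi>}" for t
    using that assms by (intro less_le_trans[OF _ r]) auto
  have ode: "(a + 1) * eval_fps g t + t * eval_fps (fps_deriv g) t = (1 - t) powr b * poly p t"
    if "norm t < 1" for t
  proof -
    have "ereal (norm t) < fps_conv_radius g"
      using that by (intro less_le_trans[OF _ r]) auto
    moreover have "ereal (norm t) < fps_conv_radius (fps_deriv g)"
      using calculation fps_conv_radius_deriv[of g] by order
    moreover have "ereal (norm t) < fps_conv_radius (fps_X * fps_deriv g)"
      using calculation(2) fps_conv_radius_mult[of fps_X "fps_deriv g"] by simp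
    moreover have "ereal (norm t) < fps_conv_radius (fps_const (a + 1) * g)"
      using calculation(1) fps_conv_radius_mult[of "fps_const (a + 1)" g] by simp
    ultimately have "eval_fps (fps_const (a + 1) * g + fps_X * fps_deriv g) t =
        (a + 1) * eval_fps g t + t * eval_fps (fps_deriv g) t"
      by (simp add: eval_fps_add eval_fps_mult)
    then show ?thesis
      using that unfolding g_def fps_integ_ODE[OF a] by (simp add: A_def hfp_coeffs_poly_eval)
  qed
  \<comment> \<open>The power need not be differentiable at 0, hence the version of the fundamental
    theorem that asks for derivatives only in the interior.\<close>
  have "((\<lambda>t. of_real t powr a * of_real (1 - t) powr b * poly p (of_real t)) has_integral
      G \<xi> - G 0) {0..\<xi>}"
  proof (rule fundamental_theorem_of_calculus_interior)
    show "continuous_on {0..\<xi>} G"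
      unfolding G_def
      by (intro continuous_intros) (use assms r' in \<open>auto simp: complex_eq_iff\<close>)
    fix t assume "t \<in> {0<..<\<xi>}"
    then have t: "0 < t" "t < 1" "t \<in> {0..\<xi>}" using assms by auto
    then have n: "of_real t \<notin> (\<real>\<^sub>\<le>\<^sub>0 :: complex set)"
      by (auto simp: complex_nonpos_Reals_iff)
    have "((\<lambda>z. z powr (a + 1) * eval_fps g z) has_field_derivative
       of_real t powr a * ((a + 1) * eval_fps g (of_real t) + of_real t * eval_fps (fps_deriv g) (of_real t)))
       (at (of_real t))"
      using DERIV_mult[OF powr_plus1_has_field_derivative[OF n] has_field_derivative_eval_fps[OF r'[OF t(3)]], of a]
    by (rule DERIV_cong) (use t in \<open>simp add: powr_add algebra_simps\<close>)
    then have "((\<lambda>z. z powr (a + 1) * eval_fps g z) \<circ> of_real has_vector_derivative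
       of_real t powr a * ((a + 1) * eval_fps g (of_real t) + of_real t * eval_fps (fps_deriv g) (of_real t)))
       (at t)"
      by (rule has_vector_derivative_real_field[unfolded o_def, folded o_def])
    then show "(G has_vector_derivative of_real t powr a * of_real (1 - t) powr b * poly p (of_real t)) (at t)"
      using ode[of "of_real t"] t by (simp add: G_def o_def mult.assoc)
  qed (use assms in auto)
  then show ?thesis
    using assms by (simp add: G_def edge_sum_poly g_def A_def)
qed

lemma hfp_split_has_integral:
  assumes "0 < \<xi>0" "\<xi>0 \<le> \<xi>1" "\<xi>1 < 1" "Re \<alpha> > -1" "Re \<beta> > -1"
  shows "((\<lambda>t. of_real t powr \<alpha> * of_real (1 - t) powr \<beta> * poly p (of_real t)) has_integral
      hfp_split \<alpha> \<beta> (poly p) \<xi>0 \<xi>1) {0..1}"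
proof -
  let ?f = "\<lambda>t. of_real t powr \<alpha> * of_real (1 - t) powr \<beta> * poly p (of_real t)"
  have b: "0 < \<xi>0" "\<xi>0 < 1" "0 < 1 - \<xi>1" "1 - \<xi>1 < 1" using assms by auto
  have 1: "(?f has_integral edge_sum \<alpha> (hfp_coeffs \<beta> (poly p)) \<xi>0) {0..\<xi>0}"
    by (rule edge_sum_has_integral[OF b(1,2) assms(4)])
  have 2: "(?f has_integral integral {\<xi>0..\<xi>1} ?f) {\<xi>0..\<xi>1}"
    by (rule integrable_integral[OF jacobi_integrand_integrable[OF assms(1,3)]])
  have 3: "(?f has_integral edge_sum \<beta> (hfp_coeffs \<alpha> (poly (reflect_poly01 p))) (1 - \<xi>1)) {\<xi>1..1}"
    using has_integral_one_minus[OF edge_sum_has_integral[OF b(3,4) assms(5), of \<alpha> "reflect_poly01 p"]]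
    by (simp add: poly_pcompose mult_ac)
  show ?thesis
    unfolding hfp_split_edge_sum poly_reflect01
    by (rule has_integral_combine[OF _ _ has_integral_combine[OF _ _ 1 2] 3]) (use assms in auto)
qed

subsection \<open>Euler's limit for the complex Beta integral\<close>

text \<open>After scaling by \<open>k\<close> the factor \<open>(1 - t / k)\<^sup>k\<close> tends to \<open>exp (- t)\<close>, and \<open>t powr Re \<alpha> / exp t\<close>
  dominates.\<close>

lemma euler_integrand_limit:
  fixes \<alpha> \<beta> :: complex and I :: "nat \<Rightarrow> complex"
  assumes \<alpha>: "Re \<alpha> > -1" and \<beta>: "Re \<beta> \<ge> 0"
    and I: "\<And>k. ((\<lambda>t. of_real t powr \<alpha> * of_real (1 - t) powr (\<beta> + of_nat k)) has_integral I k) {0..1}"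
  shows "(\<lambda>k. of_nat k powr (\<alpha> + 1) * I k) \<longlonglongrightarrow> Gamma (\<alpha> + 1)"
proof -
  \<comment> \<open>Extension by zero beyond k puts all scaled integrands on the half-line, where
    dominated convergence applies.\<close>
  define f where "f = (\<lambda>(k::nat) x. if x \<in> {0..real k}
      then of_real x powr \<alpha> * of_real (1 - x / real k) powr (\<beta> + of_nat k) else (0::complex))"
  define g where "g = (\<lambda>x. complex_of_real x powr \<alpha> / of_real (exp x))"
  define h where "h = (\<lambda>x. x powr Re \<alpha> / exp x)"
  have f: "(f k has_integral of_nat k powr (\<alpha> + 1) * I k) {0..}" for k
  \<comment> \<open>For k = 0 the interval is a point and the factor
    \<open>0 powr (\<alpha> + 1)\<close> is 0, so both sides vanish.\<close>
  proof (cases "k = 0")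
    case True
    then show ?thesis
      unfolding f_def by (subst has_integral_restrict) auto
  next
    case False
    then have k: "real k > 0" by simp
    then have k0: "complex_of_nat k \<noteq> 0" by simp
    have "(\<lambda>x. real k * x) ` {0..1} = {0..real k}"
      using k by (subst image_mult_atLeastAtMost) auto
    then have "((\<lambda>x. of_real (x / real k) powr \<alpha> * of_real (1 - x / real k) powr (\<beta> + of_nat k)) has_integral
        of_nat k * I k) {0..real k}"
      using has_integral_affinity01[OF I[of k], of "inverse (real k)" 0] k
      by (simp add: field_simps scaleR_conv_of_real)
    \<comment> \<open>One factor k comes from the change of variable; k^\<alpha> cancels the scaling
      inside (x / k)^\<alpha>.\<close>
    from has_integral_mult_right[OF this, of "of_nat k powr \<alpha>"]
    have "((\<lambda>x. of_nat k powr \<alpha> * (of_real (x / real k) powr \<alpha> * of_real (1 - x / real k) powr (\<beta> + of_nat k)))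
        has_integral of_nat k powr (\<alpha> + 1) * I k) {0..real k}"
      using k0 by (simp add: powr_add mult_ac)
    moreover have "of_nat k powr \<alpha> * of_real (x / real k) powr \<alpha> = complex_of_real x powr \<alpha>"
      if "x \<in> {0..real k}" for x
    proof -
      have "(of_real (real k) * of_real (x / real k)) powr \<alpha> =
          complex_of_real (real k) powr \<alpha> * of_real (x / real k) powr \<alpha>"
        by (rule powr_times_real) (use that k in auto)
      then show ?thesis using k by (simp flip: of_real_mult)
    qed
    ultimately have "((\<lambda>x. of_real x powr \<alpha> * of_real (1 - x / real k) powr (\<beta> + of_nat k))
        has_integral of_nat k powr (\<alpha> + 1) * I k) {0..real k}"
      by (subst has_integral_cong[where g = "\<lambda>x. of_nat k powr \<alpha> *
            (of_real (x / real k) powr \<alpha> * of_real (1 - x / real k) powr (\<beta> + of_nat k))"])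
         (auto simp flip: mult.assoc)
    then show ?thesis
      unfolding f_def by (subst has_integral_restrict) auto
  qed
  have int_h: "h integrable_on {0..}"
    using Gamma_integral_real[of "Re \<alpha> + 1"] \<alpha> by (auto simp: h_def integrable_on_def)
  have le: "norm (f k x) \<le> h x" if x: "x \<in> {0..}" for k x
  \<comment> \<open>Outside this case \<open>f k x\<close> is 0: either x exceeds k, or x = 0 and
    \<open>0 powr \<alpha>\<close> is 0.\<close>
  proof (cases "x \<le> real k \<and> x > 0")
    case True
    then have k: "real k > 0" "0 < x" by auto
    define y where "y = 1 - x / real k"
    have y: "0 \<le> y" "y \<le> 1" using True k by (auto simp: y_def field_simps)
    have "y powr (Re \<beta> + real k) \<le> exp (- x)"
    proof (cases "y = 0")
      case False
      then have "y > 0" using y by simp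
      have "y powr (Re \<beta> + real k) = y powr Re \<beta> * y ^ k"
        using \<open>y > 0\<close> by (simp add: powr_add powr_realpow)
      \<comment> \<open>The assumption Re \<beta> \<ge> 0 enters here: y lies in [0, 1], so its
        power with exponent Re \<beta> is at most 1.\<close>
      also have "\<dots> \<le> 1 * y ^ k"
        by (rule mult_right_mono) (use y \<beta> in \<open>auto intro: powr_le1\<close>)
      also have "\<dots> \<le> exp (- x)"
        using exp_ge_one_minus_x_over_n_power_n[of x k] True k by (simp add: y_def)
      finally show ?thesis .
    qed simp
    then have "x powr Re \<alpha> * y powr (Re \<beta> + real k) \<le> x powr Re \<alpha> * exp (- x)"
      by (intro mult_left_mono) auto
    moreover have "norm (complex_of_real (1 - x / real k) powr (\<beta> + of_nat k)) = y powr (Re \<beta> + real k)"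
      unfolding y_def[symmetric] using y by (subst norm_powr_real_powr) auto
    ultimately show ?thesis
      using True x by (simp add: f_def h_def norm_mult norm_powr_real_powr exp_minus field_simps del: of_real_diff)
  next
    case False
    then show ?thesis using x by (auto simp: f_def h_def)
  qed
  have lim: "(\<lambda>k. f k x) \<longlonglongrightarrow> g x" if x: "x \<in> {0..}" for x
  proof (rule Lim_transform_eventually)
    have "(\<lambda>k. x / real k) \<longlonglongrightarrow> 0"
      by (rule lim_const_over_n)
    from tendsto_diff[OF tendsto_const[of 1] this]
    have "(\<lambda>k. complex_of_real (1 - x / real k)) \<longlonglongrightarrow> of_real (1 - 0)"
      by (rule tendsto_of_real)
    then have 1: "(\<lambda>k. complex_of_real (1 - x / real k) powr \<beta>) \<longlonglongrightarrow> of_real (1 - 0) powr \<beta>"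
      by (intro tendsto_intros) auto
    have "(\<lambda>k. (1 - x / real k) ^ k) \<longlonglongrightarrow> exp (-x)"
      using tendsto_exp_limit_sequentially[of "-x"] by simp
    then have 2: "(\<lambda>k. complex_of_real ((1 - x / real k) ^ k)) \<longlonglongrightarrow> of_real (exp (-x))"
      by (rule tendsto_of_real)
    show "(\<lambda>k. of_real x powr \<alpha> * (of_real (1 - x / real k) powr \<beta> * complex_of_real ((1 - x / real k) ^ k))) \<longlonglongrightarrow> g x"
      using tendsto_mult[OF tendsto_const tendsto_mult[OF 1 2], of "of_real x powr \<alpha>"]
      by (simp add: g_def exp_minus divide_inverse flip: exp_of_real)
    \<comment> \<open>The added 1 gives x < k strictly; a nonzero base is needed to split the
      exponent \<beta> + k.\<close>
    have "eventually (\<lambda>k. k \<ge> nat \<lceil>x\<rceil> + 1) sequentially" by (rule eventually_ge_at_top)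
    then show "eventually (\<lambda>k. of_real x powr \<alpha> * (of_real (1 - x / real k) powr \<beta> *
        complex_of_real ((1 - x / real k) ^ k)) = f k x) sequentially"
    proof eventually_elim
      case (elim k)
      then have k: "x < real k" by linarith
      then have "1 - x / real k \<noteq> 0" using x by (auto simp: field_simps)
      then have "complex_of_real (1 - x / real k) \<noteq> 0" by (simp only: of_real_eq_0_iff not_False_eq_True)
      then show ?case
        using k x by (simp add: f_def powr_add powr_nat' del: of_real_diff)
    qed
  qed
  have "(\<lambda>k. integral {0..} (f k)) \<longlonglongrightarrow> integral {0..} g"
    by (rule dominated_convergence(2)[OF _ int_h le lim]) (use f in \<open>auto simp: integrable_on_def\<close>)
  moreover have "integral {0..} g = Gamma (\<alpha> + 1)"
    using Gamma_integral_complex[of "\<alpha> + 1"] \<alpha> by (intro integral_unique) (simp add: g_def)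
  ultimately show ?thesis
    using integral_unique[OF f] by simp
qed

subsection \<open>The finite part of the weight\<close>

lemma hfp_split_0:
  assumes "0 < \<xi>0" "\<xi>0 \<le> \<xi>1" "\<xi>1 < 1"
  shows "hfp_split \<alpha> \<beta> (poly 0) \<xi>0 \<xi>1 = 0"
  using hfp_split_poly_smult[OF assms, of \<alpha> \<beta> 0 0] by simp

lemma hfp_split_pCons:
  assumes "0 < \<xi>0" "\<xi>0 \<le> \<xi>1" "\<xi>1 < 1"
  shows "hfp_split \<alpha> \<beta> (poly (pCons c p)) \<xi>0 \<xi>1 =
    c * hfp_split \<alpha> \<beta> (poly 1) \<xi>0 \<xi>1 + hfp_split (\<alpha> + 1) \<beta> (poly p) \<xi>0 \<xi>1"
proof -
  have "pCons c p = smult c 1 + pCons 0 p" by simp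
  then show ?thesis
    by (simp only: hfp_split_poly_add[OF assms] hfp_split_poly_smult[OF assms] hfp_split_poly_shift[OF assms])
qed

text \<open>For p = 1 the vanishing total derivative has the polynomial factor (\<alpha> + 1) -
  (\<alpha> + \<beta> + 2) x, and x is absorbed into the exponent \<alpha>.\<close>

lemma hfp_split_1_rec_left:
  assumes "0 < \<xi>0" "\<xi>0 \<le> \<xi>1" "\<xi>1 < 1" "\<alpha> + 1 \<notin> \<int>\<^sub>\<le>\<^sub>0" "\<beta> + 1 \<notin> \<int>\<^sub>\<le>\<^sub>0"
  shows "(\<alpha> + \<beta> + 2) * hfp_split (\<alpha> + 1) \<beta> (poly 1) \<xi>0 \<xi>1 =
     (\<alpha> + 1) * hfp_split \<alpha> \<beta> (poly 1) \<xi>0 \<xi>1"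
proof -
  have "rodrigues_op \<alpha> \<beta> 1 = pCons (\<alpha> + 1) (smult (- (\<alpha> + \<beta> + 2)) 1)"
    by (simp add: rodrigues_op_def one_pCons)
  then have "0 = (\<alpha> + 1) * hfp_split \<alpha> \<beta> (poly 1) \<xi>0 \<xi>1 +
      - (\<alpha> + \<beta> + 2) * hfp_split (\<alpha> + 1) \<beta> (poly 1) \<xi>0 \<xi>1"
    using hfp_split_rodrigues_op[OF assms, of 1]
    by (simp only: hfp_split_pCons[OF assms(1-3)] hfp_split_poly_smult[OF assms(1-3)])
  then show ?thesis by (simp add: algebra_simps)
qed

lemma hfp_split_1_commute:
  assumes "0 < \<xi>0" "\<xi>0 \<le> \<xi>1" "\<xi>1 < 1"
  shows "hfp_split \<alpha> \<beta> (poly 1) \<xi>0 \<xi>1 = hfp_split \<beta> \<alpha> (poly 1) (1 - \<xi>1) (1 - \<xi>0)"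
  using hfp_split_poly_reflect[OF assms(1,3), of \<alpha> \<beta> 1] by (simp only: pcompose_1)

lemma hfp_split_1_rec_right:
  assumes "0 < \<xi>0" "\<xi>0 \<le> \<xi>1" "\<xi>1 < 1" "\<alpha> + 1 \<notin> \<int>\<^sub>\<le>\<^sub>0" "\<beta> + 1 \<notin> \<int>\<^sub>\<le>\<^sub>0"
  shows "(\<alpha> + \<beta> + 2) * hfp_split \<alpha> (\<beta> + 1) (poly 1) \<xi>0 \<xi>1 =
     (\<beta> + 1) * hfp_split \<alpha> \<beta> (poly 1) \<xi>0 \<xi>1"
  using hfp_split_1_rec_left[of "1 - \<xi>1" "1 - \<xi>0" \<beta> \<alpha>] assms
  by (simp add: hfp_split_1_commute[OF assms(1-3)] add.commute)

lemma pos_Re_notin_nonpos_Ints: "Re z > 0 \<Longrightarrow> z \<notin> \<int>\<^sub>\<le>\<^sub>0"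
  by (auto elim!: nonpos_Ints_cases)

lemma plus_of_nat_notin_nonpos_Ints:
  assumes "(z :: complex) \<notin> \<int>\<^sub>\<le>\<^sub>0"
  shows "z + of_nat n \<notin> \<int>\<^sub>\<le>\<^sub>0"
proof
  assume "z + of_nat n \<in> \<int>\<^sub>\<le>\<^sub>0"
  then obtain m where "z + of_nat n = - of_nat m" by (elim nonpos_Ints_cases')
  then have "z = - of_nat (m + n)" by (simp add: algebra_simps)
  then show False using assms by (metis minus_of_nat_in_nonpos_Ints)
qed

text \<open>Iterates the recurrence in \<beta>. The product form avoids dividing by
  \<open>pochhammer (\<alpha> + \<beta> + 2) k\<close>, which may vanish under these
  hypotheses.\<close>

lemma hfp_split_1_pochhammer:
  assumes "0 < \<xi>0" "\<xi>0 \<le> \<xi>1" "\<xi>1 < 1" "\<alpha> + 1 \<notin> \<int>\<^sub>\<le>\<^sub>0" "\<beta> + 1 \<notin> \<int>\<^sub>\<le>\<^sub>0"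
  shows "pochhammer (\<alpha> + \<beta> + 2) k * hfp_split \<alpha> (\<beta> + of_nat k) (poly 1) \<xi>0 \<xi>1 =
     pochhammer (\<beta> + 1) k * hfp_split \<alpha> \<beta> (poly 1) \<xi>0 \<xi>1"
proof (induction k)
  case (Suc k)
  have "\<beta> + of_nat k + 1 \<notin> \<int>\<^sub>\<le>\<^sub>0"
    using plus_of_nat_notin_nonpos_Ints[OF assms(5), of k] by (simp add: add_ac)
  from hfp_split_1_rec_right[OF assms(1-4) this]
  have "(\<alpha> + \<beta> + 2 + of_nat k) * hfp_split \<alpha> (\<beta> + of_nat (Suc k)) (poly 1) \<xi>0 \<xi>1 =
     (\<beta> + 1 + of_nat k) * hfp_split \<alpha> (\<beta> + of_nat k) (poly 1) \<xi>0 \<xi>1"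
    by (simp add: add_ac)
  then show ?case
    using Suc by (simp only: pochhammer_Suc mult.assoc) (simp only: mult_ac)
qed simp

text \<open>The limit of k^(\<alpha>+1) times the value at (\<alpha>, \<beta> + k) is computed
  twice: Euler's limit gives \<Gamma>(\<alpha>+1), and the iterated recurrence gives S
  \<Gamma>(\<alpha>+\<beta>+2) / \<Gamma>(\<beta>+1). Comparison determines S.\<close>

lemma hfp_split_1_Beta_convergent:
  assumes "0 < \<xi>0" "\<xi>0 \<le> \<xi>1" "\<xi>1 < 1" "Re \<alpha> > -1" "Re \<beta> \<ge> 0"
  shows "hfp_split \<alpha> \<beta> (poly 1) \<xi>0 \<xi>1 = Beta (\<alpha> + 1) (\<beta> + 1)"
proof -
  have nn: "\<alpha> + 1 \<notin> \<int>\<^sub>\<le>\<^sub>0" "\<beta> + 1 \<notin> \<int>\<^sub>\<le>\<^sub>0" "\<alpha> + \<beta> + 2 \<notin> \<int>\<^sub>\<le>\<^sub>0"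
    using assms by (auto intro!: pos_Re_notin_nonpos_Ints)
  define S where "S = hfp_split \<alpha> \<beta> (poly 1) \<xi>0 \<xi>1"
  have "((\<lambda>t. of_real t powr \<alpha> * of_real (1 - t) powr (\<beta> + of_nat k)) has_integral
      hfp_split \<alpha> (\<beta> + of_nat k) (poly 1) \<xi>0 \<xi>1) {0..1}" for k
    using hfp_split_has_integral[OF assms(1-4), of "\<beta> + of_nat k" 1] assms(5) by simp
  then have lim: "(\<lambda>k. of_nat k powr (\<alpha> + 1) * hfp_split \<alpha> (\<beta> + of_nat k) (poly 1) \<xi>0 \<xi>1)
      \<longlonglongrightarrow> Gamma (\<alpha> + 1)"
    by (rule euler_integrand_limit[OF assms(4,5)])
  \<comment> \<open>In this quotient the factorials cancel, leaving k^(\<alpha>+1) times the ratio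
    of Pochhammer symbols from the recurrence.\<close>
  have "(\<lambda>k. S * (Gamma_series' (\<alpha> + \<beta> + 2) k / Gamma_series' (\<beta> + 1) k))
      \<longlonglongrightarrow> S * (Gamma (\<alpha> + \<beta> + 2) / Gamma (\<beta> + 1))"
    using nn by (intro tendsto_intros Gamma_series'_LIMSEQ) (simp add: Gamma_eq_zero_iff)
  moreover have "eventually (\<lambda>k. S * (Gamma_series' (\<alpha> + \<beta> + 2) k / Gamma_series' (\<beta> + 1) k) =
      of_nat k powr (\<alpha> + 1) * hfp_split \<alpha> (\<beta> + of_nat k) (poly 1) \<xi>0 \<xi>1) sequentially"
    using eventually_gt_at_top[of 0]
  proof eventually_elim
    case (elim k)
    have p: "pochhammer (\<alpha> + \<beta> + 2) k \<noteq> 0" "pochhammer (\<beta> + 1) k \<noteq> 0"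
      using nn by (auto dest: pochhammer_eq_0_imp_nonpos_Int)
    have "hfp_split \<alpha> (\<beta> + of_nat k) (poly 1) \<xi>0 \<xi>1 = pochhammer (\<beta> + 1) k * S / pochhammer (\<alpha> + \<beta> + 2) k"
      using hfp_split_1_pochhammer[OF assms(1-3) nn(1,2), of k] p unfolding S_def
      by (simp add: eq_divide_eq mult.commute)
    moreover have "of_nat k powr (\<alpha> + 1) =
        exp ((\<alpha> + \<beta> + 2) * of_real (ln (of_nat k))) / exp ((\<beta> + 1) * of_real (ln (of_nat k)))"
      using elim by (simp add: powr_def Ln_of_nat algebra_simps flip: exp_diff)
    \<comment> \<open>F stands for the factorial, A and B for the exponentials, P and Q for the
      Pochhammer symbols.\<close>
    moreover have "S * ((F * A / P) / (F * B / Q)) = A / B * (Q * S / P)"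
      if "F \<noteq> 0" "P \<noteq> 0" "Q \<noteq> 0" "B \<noteq> 0" for F A B P Q :: complex
      using that by (simp add: field_simps)
    ultimately show ?case
      using p by (simp only: Gamma_series'_def) (simp only: fact_nonzero exp_not_eq_zero not_False_eq_True)
  qed
  ultimately have "(\<lambda>k. of_nat k powr (\<alpha> + 1) * hfp_split \<alpha> (\<beta> + of_nat k) (poly 1) \<xi>0 \<xi>1)
      \<longlonglongrightarrow> S * (Gamma (\<alpha> + \<beta> + 2) / Gamma (\<beta> + 1))"
    by (rule Lim_transform_eventually)
  then have "S * (Gamma (\<alpha> + \<beta> + 2) / Gamma (\<beta> + 1)) = Gamma (\<alpha> + 1)"
    using lim by (rule LIMSEQ_unique)
  moreover have "Gamma (\<alpha> + \<beta> + 2) \<noteq> 0" "Gamma (\<beta> + 1) \<noteq> 0"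
    using nn by (auto simp: Gamma_eq_zero_iff)
  moreover have "\<alpha> + 1 + (\<beta> + 1) = \<alpha> + \<beta> + 2" by simp
  ultimately show ?thesis
    by (simp only: Beta_def flip: S_def) (simp add: field_simps)
qed

text \<open>Finite part and Beta function obey the same recurrence, so equality descends from
  \<alpha> + 1 to \<alpha>. The only division is by \<alpha> + 1, which is nonzero.\<close>

lemma hfp_split_1_lower:
  assumes "0 < \<xi>0" "\<xi>0 \<le> \<xi>1" "\<xi>1 < 1" "\<alpha> + 1 \<notin> \<int>\<^sub>\<le>\<^sub>0" "\<beta> + 1 \<notin> \<int>\<^sub>\<le>\<^sub>0"
    and "hfp_split (\<alpha> + 1) \<beta> (poly 1) \<xi>0 \<xi>1 = Beta (\<alpha> + 1 + 1) (\<beta> + 1)"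
  shows "hfp_split \<alpha> \<beta> (poly 1) \<xi>0 \<xi>1 = Beta (\<alpha> + 1) (\<beta> + 1)"
proof -
  have "\<alpha> + 1 \<noteq> 0" using assms(4) by auto
  have "(\<alpha> + 1) * hfp_split \<alpha> \<beta> (poly 1) \<xi>0 \<xi>1 = (\<alpha> + 1 + (\<beta> + 1)) * Beta (\<alpha> + 1 + 1) (\<beta> + 1)"
    using hfp_split_1_rec_left[OF assms(1-5)] assms(6) by (simp add: add_ac)
  also have "\<dots> = (\<alpha> + 1) * Beta (\<alpha> + 1) (\<beta> + 1)"
    by (rule Beta_plus1_left[OF assms(4)])
  finally show ?thesis using \<open>\<alpha> + 1 \<noteq> 0\<close> by simp
qed

text \<open>Descends in \<alpha> from the half-plane Re \<alpha> > -1; the induction counts the unit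
  steps needed to reach it.\<close>

lemma hfp_split_1_Beta_right:
  assumes "0 < \<xi>0" "\<xi>0 \<le> \<xi>1" "\<xi>1 < 1" "Re \<beta> \<ge> 0" "\<alpha> + 1 \<notin> \<int>\<^sub>\<le>\<^sub>0"
  shows "hfp_split \<alpha> \<beta> (poly 1) \<xi>0 \<xi>1 = Beta (\<alpha> + 1) (\<beta> + 1)"
proof -
  have \<beta>: "\<beta> + 1 \<notin> \<int>\<^sub>\<le>\<^sub>0" using assms(4) by (intro pos_Re_notin_nonpos_Ints) auto
  have "Re \<alpha> + real n > -1 \<Longrightarrow> \<alpha> + 1 \<notin> \<int>\<^sub>\<le>\<^sub>0 \<Longrightarrow>
      hfp_split \<alpha> \<beta> (poly 1) \<xi>0 \<xi>1 = Beta (\<alpha> + 1) (\<beta> + 1)" for n \<alpha>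
  proof (induction n arbitrary: \<alpha>)
    case 0
    then show ?case by (intro hfp_split_1_Beta_convergent[OF assms(1-3) _ assms(4)]) auto
  next
    case (Suc n)
    have "\<alpha> + 1 + 1 \<notin> \<int>\<^sub>\<le>\<^sub>0"
      using plus_of_nat_notin_nonpos_Ints[OF Suc.prems(2), of 1] by simp
    moreover have "Re (\<alpha> + 1) + real n > -1" using Suc.prems(1) by simp
    ultimately have "hfp_split (\<alpha> + 1) \<beta> (poly 1) \<xi>0 \<xi>1 = Beta (\<alpha> + 1 + 1) (\<beta> + 1)"
      by (intro Suc.IH)
    then show ?case
      by (rule hfp_split_1_lower[OF assms(1-3) Suc.prems(2) \<beta>])
  qed
  moreover obtain n where "real n > -1 - Re \<alpha>" using reals_Archimedean2 by blast
  then have "Re \<alpha> + real n > -1" by linarith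
  ultimately show ?thesis using assms(5) by blast
qed

text \<open>The same descent in \<beta>, carried out on the reflected splitting, where \<beta> is
  the left exponent.\<close>

lemma hfp_split_1_Beta:
  assumes "0 < \<xi>0" "\<xi>0 \<le> \<xi>1" "\<xi>1 < 1" "\<alpha> + 1 \<notin> \<int>\<^sub>\<le>\<^sub>0" "\<beta> + 1 \<notin> \<int>\<^sub>\<le>\<^sub>0"
  shows "hfp_split \<alpha> \<beta> (poly 1) \<xi>0 \<xi>1 = Beta (\<alpha> + 1) (\<beta> + 1)"
proof -
  have b: "0 < 1 - \<xi>1" "1 - \<xi>1 \<le> 1 - \<xi>0" "1 - \<xi>0 < 1" using assms by auto
  have "Re \<beta> + real n \<ge> 0 \<Longrightarrow> \<beta> + 1 \<notin> \<int>\<^sub>\<le>\<^sub>0 \<Longrightarrow>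
      hfp_split \<alpha> \<beta> (poly 1) \<xi>0 \<xi>1 = Beta (\<alpha> + 1) (\<beta> + 1)" for n \<beta>
  proof (induction n arbitrary: \<beta>)
    case 0
    then show ?case by (intro hfp_split_1_Beta_right[OF assms(1-3) _ assms(4)]) auto
  next
    case (Suc n)
    have "\<beta> + 1 + 1 \<notin> \<int>\<^sub>\<le>\<^sub>0"
      using plus_of_nat_notin_nonpos_Ints[OF Suc.prems(2), of 1] by simp
    moreover have "Re (\<beta> + 1) + real n \<ge> 0" using Suc.prems(1) by simp
    ultimately have "hfp_split \<alpha> (\<beta> + 1) (poly 1) \<xi>0 \<xi>1 = Beta (\<alpha> + 1) (\<beta> + 1 + 1)"
      by (intro Suc.IH)
    then have "hfp_split (\<beta> + 1) \<alpha> (poly 1) (1 - \<xi>1) (1 - \<xi>0) = Beta (\<beta> + 1 + 1) (\<alpha> + 1)"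
      by (simp add: hfp_split_1_commute[OF assms(1-3)] Beta_commute)
    from hfp_split_1_lower[OF b Suc.prems(2) assms(4) this]
    show ?case
      by (simp only: hfp_split_1_commute[OF assms(1-3)] Beta_commute)
  qed
  moreover obtain n where "real n > - Re \<beta>" using reals_Archimedean2 by blast
  then have "Re \<beta> + real n \<ge> 0" by linarith
  ultimately show ?thesis using assms(5) by blast
qed

text \<open>The Beta value of the weight does not involve the cut points. Writing a polynomial as c
  + x p and absorbing x into \<alpha> carries this over, so the induction must let \<alpha> vary.
  The reference cut 1/2 makes the middle interval a single point.\<close>

lemma hfp_split_poly_independent:
  assumes "0 < \<xi>0" "\<xi>0 \<le> \<xi>1" "\<xi>1 < 1" "\<alpha> + 1 \<notin> \<int>\<^sub>\<le>\<^sub>0" "\<beta> + 1 \<notin> \<int>\<^sub>\<le>\<^sub>0"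
  shows "hfp_split \<alpha> \<beta> (poly p) \<xi>0 \<xi>1 = hfp_split \<alpha> \<beta> (poly p) (1/2) (1/2)"
  using assms(4)
proof (induction p arbitrary: \<alpha>)
  case 0
  then show ?case by (simp add: hfp_split_0[OF assms(1-3)] hfp_split_0[of "1/2" "1/2"] del: poly_0)
next
  case (pCons c p)
  have "\<alpha> + 1 + 1 \<notin> \<int>\<^sub>\<le>\<^sub>0"
    using plus_of_nat_notin_nonpos_Ints[OF pCons.prems, of 1] by simp
  then have IH: "hfp_split (\<alpha> + 1) \<beta> (poly p) \<xi>0 \<xi>1 = hfp_split (\<alpha> + 1) \<beta> (poly p) (1/2) (1/2)"
    by (rule pCons.IH)
  have h: "0 < (1/2::real)" "1/2 \<le> (1/2::real)" "1/2 < (1::real)" by auto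
  show ?case
    by (simp only: hfp_split_pCons[OF assms(1-3)] hfp_split_pCons[OF h] IH
        hfp_split_1_Beta[OF assms(1-3) pCons.prems assms(5)] hfp_split_1_Beta[OF h pCons.prems assms(5)])
qed

lemma hfp_admissible_poly:
  assumes "0 < \<xi>0" "\<xi>0 \<le> \<xi>1" "\<xi>1 < 1"
  shows "hfp_admissible \<alpha> \<beta> (poly p) \<xi>0 \<xi>1"
  unfolding hfp_admissible_def poly_reflect01 using assms
  by (auto intro!: less_le_trans[OF _ hfp_coeffs_poly_conv_radius])

lemma hadamard_fp_poly:
  assumes "\<alpha> + 1 \<notin> \<int>\<^sub>\<le>\<^sub>0" "\<beta> + 1 \<notin> \<int>\<^sub>\<le>\<^sub>0"
  shows "hadamard_fp \<alpha> \<beta> (poly p) = hfp_split \<alpha> \<beta> (poly p) (1/2) (1/2)"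
  unfolding hadamard_fp_def
proof (rule the_equality)
  show "\<forall>\<xi>0 \<xi>1. hfp_admissible \<alpha> \<beta> (poly p) \<xi>0 \<xi>1 \<longrightarrow>
      hfp_split \<alpha> \<beta> (poly p) \<xi>0 \<xi>1 = hfp_split \<alpha> \<beta> (poly p) (1/2) (1/2)"
    unfolding hfp_admissible_def by (intro allI impI hfp_split_poly_independent assms) blast+
next
  fix v
  assume "\<forall>\<xi>0 \<xi>1. hfp_admissible \<alpha> \<beta> (poly p) \<xi>0 \<xi>1 \<longrightarrow> hfp_split \<alpha> \<beta> (poly p) \<xi>0 \<xi>1 = v"
  \<comment> \<open>Some admissible pair must exist, as otherwise every v would satisfy the
    condition vacuously.\<close>
  moreover have "hfp_admissible \<alpha> \<beta> (poly p) (1/2) (1/2)"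
    by (rule hfp_admissible_poly) auto
  ultimately show "v = hfp_split \<alpha> \<beta> (poly p) (1/2) (1/2)"
    by blast
qed

subsection \<open>Rodrigues formula and orthogonality\<close>

text \<open>The recursion shifts \<open>\<alpha>\<close>, \<open>\<beta>\<close> because \<open>(x - x\<^sup>2)\<^bsup>n+1\<^esup>\<close> times the weight for \<open>(\<alpha>, \<beta>)\<close> is
  \<open>(x - x\<^sup>2)\<^sup>n\<close> times the weight for \<open>(\<alpha> + 1, \<beta> + 1)\<close>.\<close>

primrec jacobi_rec :: "nat \<Rightarrow> complex \<Rightarrow> complex \<Rightarrow> complex poly" where
  "jacobi_rec 0 \<alpha> \<beta> = 1"
| "jacobi_rec (Suc n) \<alpha> \<beta> = rodrigues_op \<alpha> \<beta> (jacobi_rec n (\<alpha> + 1) (\<beta> + 1))"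

text \<open>Proved on the open strip rather than on the real interval: the complex derivative in the
  induction step needs the hypothesis on a whole neighbourhood.\<close>

lemma higher_deriv_jacobi_weight:
  assumes "0 < Re z" "Re z < 1"
  shows "(deriv ^^ n) (\<lambda>z. (z - z\<^sup>2) ^ n * jacobi_weight \<alpha> \<beta> z) z =
    jacobi_weight \<alpha> \<beta> z * poly (jacobi_rec n \<alpha> \<beta>) z"
  using assms
proof (induction n arbitrary: \<alpha> \<beta> z)
  case (Suc n)
  define U where "U = {z. 0 < Re z} \<inter> {z. Re z < 1}"
  have U: "open U" unfolding U_def by (intro open_Int open_halfspace_Re_gt open_halfspace_Re_lt)
  have z: "z \<in> U" using Suc.prems by (simp add: U_def)
  have "eventually (\<lambda>w. w \<in> U) (nhds z)" using U z by (rule eventually_nhds_in_open)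
  then have ev: "eventually (\<lambda>w. (w - w\<^sup>2) ^ Suc n * jacobi_weight \<alpha> \<beta> w =
      (w - w\<^sup>2) ^ n * jacobi_weight (\<alpha> + 1) (\<beta> + 1) w) (nhds z)"
  proof eventually_elim
    case (elim w)
    then have "w \<noteq> 0" "1 - w \<noteq> 0" by (auto simp: U_def)
    then show ?case by (simp add: jacobi_weight_def powr_add power2_eq_square algebra_simps)
  qed
  have "(deriv ^^ Suc n) (\<lambda>z. (z - z\<^sup>2) ^ Suc n * jacobi_weight \<alpha> \<beta> z) z =
      (deriv ^^ Suc n) (\<lambda>z. (z - z\<^sup>2) ^ n * jacobi_weight (\<alpha> + 1) (\<beta> + 1) z) z"
    by (intro higher_deriv_cong_ev ev refl)
  also have "\<dots> = deriv ((deriv ^^ n) (\<lambda>z. (z - z\<^sup>2) ^ n * jacobi_weight (\<alpha> + 1) (\<beta> + 1) z)) z"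
    by simp
  also have "\<dots> = deriv (\<lambda>z. jacobi_weight (\<alpha> + 1) (\<beta> + 1) z * poly (jacobi_rec n (\<alpha> + 1) (\<beta> + 1)) z) z"
  proof (rule deriv_cong_ev)
    show "eventually (\<lambda>w. (deriv ^^ n) (\<lambda>z. (z - z\<^sup>2) ^ n * jacobi_weight (\<alpha> + 1) (\<beta> + 1) z) w =
        jacobi_weight (\<alpha> + 1) (\<beta> + 1) w * poly (jacobi_rec n (\<alpha> + 1) (\<beta> + 1)) w) (nhds z)"
      using eventually_nhds_in_open[OF U z]
      by eventually_elim (rule Suc.IH; simp add: U_def)
  qed simp
  also have "\<dots> = jacobi_weight \<alpha> \<beta> z * poly (jacobi_rec (Suc n) \<alpha> \<beta>) z"
    unfolding jacobi_weight_def jacobi_rec.simps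
    by (rule DERIV_imp_deriv, rule jacobi_weight_has_field_derivative)
       (use Suc.prems in \<open>auto simp: complex_nonpos_Reals_iff\<close>)
  finally show ?case .
qed simp

text \<open>A nonzero difference would have infinitely many roots. This is the uniqueness behind
  \<open>THE\<close> in \<open>jacobi_poly\<close>.\<close>

lemma poly_eqI_Ioo:
  fixes p q :: "complex poly"
  assumes "\<And>x. x \<in> {0<..<1::real} \<Longrightarrow> poly p (of_real x) = poly q (of_real x)"
  shows "p = q"
proof (rule ccontr)
  assume "p \<noteq> q"
  then have "finite {z. poly (p - q) z = 0}" by (intro poly_roots_finite) auto
  moreover have "of_real ` {0<..<1::real} \<subseteq> {z. poly (p - q) z = 0}" using assms by auto
  ultimately have "finite (complex_of_real ` {0<..<1::real})" by (rule finite_subset[rotated])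
  then have "finite {0<..<1::real}" by (rule finite_imageD) (auto simp: inj_on_def)
  then show False by (simp add: infinite_Ioo)
qed

lemma jacobi_poly_eq_rec: "jacobi_poly \<alpha> \<beta> n = jacobi_rec n \<alpha> \<beta>"
proof -
  have *: "inverse (jacobi_weight \<alpha> \<beta> (of_real x))
      * (deriv ^^ n) (\<lambda>z. (z - z\<^sup>2) ^ n * jacobi_weight \<alpha> \<beta> z) (of_real x) =
      poly (jacobi_rec n \<alpha> \<beta>) (of_real x)" if "x \<in> {0<..<1}" for x
  proof -
    have "jacobi_weight \<alpha> \<beta> (of_real x) \<noteq> 0"
      using that by (auto simp: jacobi_weight_def)
    then show ?thesis
      using that by (simp add: higher_deriv_jacobi_weight)
  qed
  show ?thesis
    unfolding jacobi_poly_def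
    by (rule the_equality) (auto simp: * intro: poly_eqI_Ioo)
qed

section \<open>Degrees and leading coefficients\<close>

lemma degree_rodrigues_op: "degree (rodrigues_op \<alpha> \<beta> p) \<le> Suc (degree p)"
proof -
  have 1: "degree ([:\<alpha> + 1, - (\<alpha> + \<beta> + 2):] * p) \<le> Suc (degree p)"
    by (rule order.trans[OF degree_mult_le]) simp
  have "degree ([:0, 1, -1:] * pderiv p) \<le> 2 + (degree p - 1)"
    by (rule order.trans[OF degree_mult_le]) (simp add: degree_pderiv)
  \<comment> \<open>For constants truncated subtraction makes the bound 2 + (0 - 1) equal to 2, one
    too large, so this case uses that the derivative is 0.\<close>
  moreover have "pderiv p = 0" if "degree p = 0" using that by (simp add: pderiv_eq_0_iff)
  ultimately have 2: "degree ([:0, 1, -1:] * pderiv p) \<le> Suc (degree p)"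
    by (cases "degree p = 0") auto
  show ?thesis unfolding rodrigues_op_def by (rule degree_add_le[OF 1 2])
qed

lemma degree_jacobi_rec: "degree (jacobi_rec n \<alpha> \<beta>) \<le> n"
proof (induction n arbitrary: \<alpha> \<beta>)
  case (Suc n)
  show ?case
    using degree_rodrigues_op[of \<alpha> \<beta> "jacobi_rec n (\<alpha> + 1) (\<beta> + 1)"] Suc[of "\<alpha> + 1" "\<beta> + 1"]
    by simp
qed simp

text \<open>The summand - n comes from - x^2 p'. Only a degree bound is assumed, so the formula also
  covers a vanishing coefficient of x^n.\<close>

lemma coeff_rodrigues_op:
  assumes "degree p \<le> n"
  shows "coeff (rodrigues_op \<alpha> \<beta> p) (Suc n) = - (\<alpha> + \<beta> + 2 + of_nat n) * coeff p n"
proof -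
  have "coeff p (Suc n) = 0" "coeff p (Suc (Suc n)) = 0"
    using assms by (auto intro: coeff_eq_0)
  then show ?thesis
    by (cases n) (auto simp: rodrigues_op_def coeff_pCons coeff_pderiv algebra_simps)
qed

lemma coeff_jacobi_rec: "coeff (jacobi_rec n \<alpha> \<beta>) n = jacobi_lead \<alpha> \<beta> n"
proof (induction n arbitrary: \<alpha> \<beta>)
  case 0
  then show ?case by (simp add: jacobi_lead_def)
next
  case (Suc n)
  \<comment> \<open>The factor for k = 1 is the new one; after an index shift the others are those
    of degree n for \<alpha> + 1 and \<beta> + 1.\<close>
  have "(\<Prod>k=1..Suc n. of_nat k + of_nat (Suc n) + \<alpha> + \<beta>) =
      (\<alpha> + \<beta> + 2 + of_nat n) * (\<Prod>k=Suc 1..Suc n. of_nat k + of_nat (Suc n) + \<alpha> + \<beta>)"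
    by (subst prod.atLeast_Suc_atMost) (simp_all add: algebra_simps)
  also have "(\<Prod>k=Suc 1..Suc n. of_nat k + of_nat (Suc n) + \<alpha> + \<beta>) =
      (\<Prod>k=1..n. of_nat k + of_nat n + (\<alpha> + 1) + (\<beta> + 1))"
    by (subst prod.shift_bounds_cl_Suc_ivl) (simp add: algebra_simps)
  finally have P: "(\<Prod>k=1..Suc n. of_nat k + of_nat (Suc n) + \<alpha> + \<beta>) =
      (\<alpha> + \<beta> + 2 + of_nat n) * (\<Prod>k=1..n. of_nat k + of_nat n + (\<alpha> + 1) + (\<beta> + 1))" .
  show ?case
    by (simp only: jacobi_rec.simps coeff_rodrigues_op[OF degree_jacobi_rec] Suc.IH jacobi_lead_def P power_Suc)
       (simp only: mult_ac mult_minus_left mult_minus_right mult_1_left)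
qed

section \<open>Integration by parts, orthogonality and the norm\<close>

lemma hadamard_fp_jacobi_rec:
  assumes "\<alpha> + 1 \<notin> \<int>\<^sub>\<le>\<^sub>0" "\<beta> + 1 \<notin> \<int>\<^sub>\<le>\<^sub>0"
  shows "hadamard_fp \<alpha> \<beta> (poly (jacobi_rec n \<alpha> \<beta> * g)) =
    (-1) ^ n * hadamard_fp (\<alpha> + of_nat n) (\<beta> + of_nat n) (poly ((pderiv ^^ n) g))"
  using assms
proof (induction n arbitrary: \<alpha> \<beta> g)
  case (Suc n)
  let ?r = "jacobi_rec n (\<alpha> + 1) (\<beta> + 1)"
  have h: "0 < (1/2::real)" "1/2 \<le> (1/2::real)" "1/2 < (1::real)" by auto
  have nn: "\<alpha> + 1 + 1 \<notin> \<int>\<^sub>\<le>\<^sub>0" "\<beta> + 1 + 1 \<notin> \<int>\<^sub>\<le>\<^sub>0"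
    using plus_of_nat_notin_nonpos_Ints[OF Suc.prems(1), of 1]
      plus_of_nat_notin_nonpos_Ints[OF Suc.prems(2), of 1] by auto
  \<comment> \<open>The product rule T(r g) = T'(r) g + x (1 - x) r g' with T = T' =
    \<open>rodrigues_op \<alpha> \<beta>\<close>. The first summand on the right of
    \<open>eq\<close> has finite part 0, and in the second x (1 - x) raises both exponents by
    one.\<close>
  have eq: "jacobi_rec (Suc n) \<alpha> \<beta> * g =
      rodrigues_op \<alpha> \<beta> (?r * g) + smult (-1) (pCons 0 ([:1, -1:] * (?r * pderiv g)))"
    by (rule poly_eq_poly_eq_iff[THEN iffD1])
       (simp add: fun_eq_iff poly_rodrigues_op pderiv_mult algebra_simps)
  have "hadamard_fp \<alpha> \<beta> (poly (jacobi_rec (Suc n) \<alpha> \<beta> * g)) =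
      - hadamard_fp (\<alpha> + 1) (\<beta> + 1) (poly (?r * pderiv g))"
    unfolding hadamard_fp_poly[OF Suc.prems] hadamard_fp_poly[OF nn] eq
    by (simp only: hfp_split_poly_add[OF h] hfp_split_rodrigues_op[OF h Suc.prems]
        hfp_split_poly_smult[OF h] hfp_split_poly_shift[OF h] hfp_split_poly_shift_one_minus[OF h])
       simp
  also have "\<dots> = - ((-1) ^ n * hadamard_fp (\<alpha> + 1 + of_nat n) (\<beta> + 1 + of_nat n)
      (poly ((pderiv ^^ n) (pderiv g))))"
    by (simp only: Suc.IH[OF nn])
  also have "\<dots> = (-1) ^ Suc n * hadamard_fp (\<alpha> + of_nat (Suc n)) (\<beta> + of_nat (Suc n))
      (poly ((pderiv ^^ Suc n) g))"
    by (simp add: funpow_Suc_right add_ac del: funpow.simps)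
  finally show ?case .
qed simp

text \<open>The degree is at most k, so n derivatives leave at most n! times the coefficient of
  x^n.\<close>

lemma higher_pderiv_jacobi_rec:
  assumes "k \<le> n"
  shows "(pderiv ^^ n) (jacobi_rec k \<alpha> \<beta>) =
    (if k = n then [:fact n * jacobi_lead \<alpha> \<beta> n:] else 0)"
proof (rule poly_eqI)
  fix i
  have "coeff (jacobi_rec k \<alpha> \<beta>) (i + n) = 0" if "i > 0 \<or> k < n"
    using that assms degree_jacobi_rec[of k \<alpha> \<beta>] by (intro coeff_eq_0) auto
  then show "coeff ((pderiv ^^ n) (jacobi_rec k \<alpha> \<beta>)) i =
      coeff (if k = n then [:fact n * jacobi_lead \<alpha> \<beta> n:] else 0) i"
    using assms
    by (auto simp: coeff_higher_pderiv coeff_jacobi_rec coeff_pCons pochhammer_fact split: nat.split)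
qed

lemma jacobi_form_eq: "jacobi_form \<alpha> \<beta> f g = hadamard_fp \<alpha> \<beta> (poly (f * g))"
  by (simp add: jacobi_form_def poly_mult[abs_def])

theorem theorem11:
  fixes \<alpha> \<beta> :: complex
  assumes "\<alpha> \<notin> {- of_nat k |k. k \<ge> 1}"
    and "\<beta> \<notin> {- of_nat k |k. k \<ge> 1}"
    and "\<alpha> + \<beta> \<notin> {- of_nat k |k. k \<ge> 2}"
  shows "\<forall>n k :: nat.
    (k \<noteq> n \<longrightarrow> jacobi_form \<alpha> \<beta> (jacobi_poly \<alpha> \<beta> n) (jacobi_poly \<alpha> \<beta> k) = 0)
    \<and> jacobi_form \<alpha> \<beta> (jacobi_poly \<alpha> \<beta> n) (jacobi_poly \<alpha> \<beta> n) =
        (-1) ^ n * fact n * jacobi_lead \<alpha> \<beta> n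
        * (Gamma (\<alpha> + of_nat n + 1) * Gamma (\<beta> + of_nat n + 1)
           / Gamma (\<alpha> + \<beta> + 2 * of_nat n + 2))
    \<and> jacobi_form \<alpha> \<beta> (jacobi_poly \<alpha> \<beta> n) (jacobi_poly \<alpha> \<beta> n) \<noteq> 0"
proof -
  have h: "0 < (1/2::real)" "1/2 \<le> (1/2::real)" "1/2 < (1::real)" by auto
  \<comment> \<open>Translates the excluded sets into non-poles of Gamma; it is used with m = 1 for
    \<alpha> and \<beta>, and with m = 2 for their sum.\<close>
  have shift: "z + of_nat m \<notin> \<int>\<^sub>\<le>\<^sub>0" if "z \<notin> {- of_nat k |k. k \<ge> m}" for z :: complex and m
  proof
    assume "z + of_nat m \<in> \<int>\<^sub>\<le>\<^sub>0"
    then obtain j where "z + of_nat m = - of_nat j" by (elim nonpos_Ints_cases')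
    then have "z = - of_nat (m + j)" by (simp add: algebra_simps)
    then have "z \<in> {- of_nat k |k. k \<ge> m}" by (auto intro!: exI[of _ "m + j"] simp del: of_nat_add)
    then show False using that by contradiction
  qed
  have nn: "\<alpha> + 1 \<notin> \<int>\<^sub>\<le>\<^sub>0" "\<beta> + 1 \<notin> \<int>\<^sub>\<le>\<^sub>0" "\<alpha> + \<beta> + 2 \<notin> \<int>\<^sub>\<le>\<^sub>0"
    using shift[OF assms(1)] shift[OF assms(2)] shift[OF assms(3)] by simp_all
  have nn': "\<alpha> + of_nat n + 1 \<notin> \<int>\<^sub>\<le>\<^sub>0" "\<beta> + of_nat n + 1 \<notin> \<int>\<^sub>\<le>\<^sub>0"
      "\<alpha> + \<beta> + 2 * of_nat n + 2 \<notin> \<int>\<^sub>\<le>\<^sub>0" for n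
    using plus_of_nat_notin_nonpos_Ints[OF nn(1), of n] plus_of_nat_notin_nonpos_Ints[OF nn(2), of n]
      plus_of_nat_notin_nonpos_Ints[OF nn(3), of "2 * n"] by (simp_all add: add_ac)
  have orth: "jacobi_form \<alpha> \<beta> (jacobi_poly \<alpha> \<beta> n) (jacobi_poly \<alpha> \<beta> k) = 0" if "k < n" for n k
    using that hadamard_fp_jacobi_rec[OF nn(1,2), of n "jacobi_rec k \<alpha> \<beta>"] hfp_split_0[OF h]
    by (simp add: jacobi_form_eq jacobi_poly_eq_rec higher_pderiv_jacobi_rec hadamard_fp_poly[OF nn'(1,2)]
        del: poly_0)
  \<comment> \<open>Differentiation kills only a factor of smaller index; symmetry covers the case k
    > n.\<close>
  have commute: "jacobi_form \<alpha> \<beta> f g = jacobi_form \<alpha> \<beta> g f" for f g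
    by (simp add: jacobi_form_eq mult.commute)
  have val: "jacobi_form \<alpha> \<beta> (jacobi_poly \<alpha> \<beta> n) (jacobi_poly \<alpha> \<beta> n) =
        (-1) ^ n * fact n * jacobi_lead \<alpha> \<beta> n
        * (Gamma (\<alpha> + of_nat n + 1) * Gamma (\<beta> + of_nat n + 1)
           / Gamma (\<alpha> + \<beta> + 2 * of_nat n + 2))" for n
  proof -
    have c: "[:c:] = smult c 1" for c :: complex by simp
    have "jacobi_form \<alpha> \<beta> (jacobi_poly \<alpha> \<beta> n) (jacobi_poly \<alpha> \<beta> n) =
      (-1) ^ n * (fact n * jacobi_lead \<alpha> \<beta> n * Beta (\<alpha> + of_nat n + 1) (\<beta> + of_nat n + 1))"
      by (simp only: jacobi_form_eq jacobi_poly_eq_rec hadamard_fp_jacobi_rec[OF nn(1,2)]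
          higher_pderiv_jacobi_rec order.refl if_True refl hadamard_fp_poly[OF nn'(1,2)] c
          hfp_split_poly_smult[OF h] hfp_split_1_Beta[OF h nn'(1,2)])
    moreover have "\<alpha> + of_nat n + 1 + (\<beta> + of_nat n + 1) = \<alpha> + \<beta> + 2 * of_nat n + 2"
      by simp
    ultimately show ?thesis by (simp only: Beta_def mult.assoc)
  qed
  have "jacobi_lead \<alpha> \<beta> n \<noteq> 0" for n
  proof -
    \<comment> \<open>A zero factor would give \<alpha> + \<beta> = -(k + n), and k + n \<ge> 2
      because 1 \<le> k \<le> n.\<close>
    have "of_nat k + of_nat n + \<alpha> + \<beta> \<noteq> 0" if "k \<in> {1..n}" for k
    proof
      assume "of_nat k + of_nat n + \<alpha> + \<beta> = 0"
      then have "(\<alpha> + \<beta>) + of_nat (k + n) = 0" by (simp add: add_ac)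
      then have "\<alpha> + \<beta> = - of_nat (k + n)" by (simp only: eq_neg_iff_add_eq_0)
      then have "\<alpha> + \<beta> \<in> {- of_nat k |k. k \<ge> 2}"
        using that by (auto intro!: exI[of _ "k + n"] simp del: of_nat_add)
      then show False using assms(3) by contradiction
    qed
    then show ?thesis by (simp add: jacobi_lead_def)
  qed
  \<comment> \<open>Gamma takes the default value 0 at its poles, so all three arguments, including
    that in the denominator, must be known to avoid them.\<close>
  then have "jacobi_form \<alpha> \<beta> (jacobi_poly \<alpha> \<beta> n) (jacobi_poly \<alpha> \<beta> n) \<noteq> 0" for n
    using nn' by (simp add: val Gamma_eq_zero_iff)
  moreover have "jacobi_form \<alpha> \<beta> (jacobi_poly \<alpha> \<beta> n) (jacobi_poly \<alpha> \<beta> k) = 0" if "k \<noteq> n" for n k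
    using orth[of k n] orth[of n k] commute[of "jacobi_poly \<alpha> \<beta> n" "jacobi_poly \<alpha> \<beta> k"] that
    by (cases "k < n") auto
  ultimately show ?thesis
    using val by blast
qed

end
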